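(* Let $\nu\in\mathbb{R}$, $\beta>0$ and $g\in\mathcal{S}_0(\mathbb{R})$. If there exists a nonzero $f\in L^2_\nu(0,1)$ such that $V_gf(0,\beta n)=0$ for all $n\in\mathbb{Z}$, then $\mathcal{G}(g,\Lambda_{1,\beta})$ is not a Gabor frame for $L^2(\mathbb{R})$.
   Context: $L^2_\nu(0,1)$ is the Hilbert space of measurable $f:\mathbb{R}\to\mathbb{C}$ with $f(t+k)=e^{2\pi ik\nu}f(t)$ for all $k\in\mathbb{Z}$ and $\int_0^1|f|^2<\infty$. $M_\xi f(t)=e^{2\pi i\xi t}f(t)$, $T_xf(t)=f(t-x)$, $V_gf(x,\xi)=\int_{\mathbb{R}}f(t)\overline{g(t-x)}e^{-2\pi i\xi t}dt$, $h_0(t)=2^{1/4}e^{-\pi t^2}$, and $\mathcal{S}_0(\mathbb{R})=\{g\in L^2(\mathbb{R}):V_{h_0}g\in L^1(\mathbb{R}^2)\}$. Windows $g$ are normalized by $\|g\|_{L^2(\mathbb{R})}=1$. $\Lambda_{1,\beta}=\mathbb{Z}\times\beta\mathbb{Z}$ and $\mathcal{G}(g,\Lambda_{1,\beta})=\{M_{\beta n}T_kg:k,n\in\mathbb{Z}\}$, which is a Gabor frame for $L^2(\mathbb{R})$ if it is a frame of that Hilbert space. *)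

theory Defs
  imports "HOL-Analysis.Analysis"
begin

text \<open>Elements of L2 spaces are represented by Lebesgue measurable functions; equality in the
  Hilbert space is equality almost everywhere.\<close>

definition L2_space :: "(real \<Rightarrow> complex) set" where
  "L2_space = {f \<in> borel_measurable lebesgue. integrable lebesgue (\<lambda>t. (cmod (f t))\<^sup>2)}"

definition L2_inner :: "(real \<Rightarrow> complex) \<Rightarrow> (real \<Rightarrow> complex) \<Rightarrow> complex" where
  "L2_inner f g = (LINT t|lebesgue. f t * cnj (g t))"

definition L2_norm :: "(real \<Rightarrow> complex) \<Rightarrow> real" where
  "L2_norm f = sqrt (LINT t|lebesgue. (cmod (f t))\<^sup>2)"

text \<open>The quasi-periodicity relation is imposed pointwise; every class of functions satisfying it
  almost everywhere has such a representative.\<close>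

definition L2_quasi :: "real \<Rightarrow> (real \<Rightarrow> complex) set" where
  "L2_quasi \<nu> = {f \<in> borel_measurable lebesgue.
     (\<forall>t. \<forall>k::int. f (t + of_int k) = cis (2 * pi * of_int k * \<nu>) * f t) \<and>
     set_integrable lebesgue {0<..<1} (\<lambda>t. (cmod (f t))\<^sup>2)}"

definition modulation :: "real \<Rightarrow> (real \<Rightarrow> complex) \<Rightarrow> real \<Rightarrow> complex" where
  "modulation \<xi> f = (\<lambda>t. cis (2 * pi * \<xi> * t) * f t)"

definition translation :: "real \<Rightarrow> (real \<Rightarrow> complex) \<Rightarrow> real \<Rightarrow> complex" where
  "translation x f = (\<lambda>t. f (t - x))"

text \<open>The first argument is the window. The integral converges absolutely if both functions are
  in \<open>L2_space\<close>, and also if the window is in \<open>S0_space\<close> below and the function in \<open>L2_quasi \<nu>\<close>.\<close>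

definition stft :: "(real \<Rightarrow> complex) \<Rightarrow> (real \<Rightarrow> complex) \<Rightarrow> real \<Rightarrow> real \<Rightarrow> complex" where
  "stft g f x \<xi> = (LINT t|lebesgue. f t * cnj (g (t - x)) * cis (- 2 * pi * \<xi> * t))"

definition gauss_window :: "real \<Rightarrow> complex" where
  "gauss_window t = of_real (2 powr (1/4) * exp (- pi * t\<^sup>2))"

definition S0_space :: "(real \<Rightarrow> complex) set" where
  "S0_space = {g \<in> L2_space.
     integrable (lebesgue :: (real \<times> real) measure) (\<lambda>(x, \<xi>). stft gauss_window g x \<xi>)}"

definition L2_frame :: "'i set \<Rightarrow> ('i \<Rightarrow> real \<Rightarrow> complex) \<Rightarrow> bool" where
  "L2_frame I \<phi> \<longleftrightarrow> (\<forall>i\<in>I. \<phi> i \<in> L2_space) \<and>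
     (\<exists>A>0. \<exists>B>0. \<forall>f\<in>L2_space.
        (\<lambda>i. (cmod (L2_inner f (\<phi> i)))\<^sup>2) summable_on I \<and>
        A * (L2_norm f)\<^sup>2 \<le> (\<Sum>\<^sub>\<infinity>i\<in>I. (cmod (L2_inner f (\<phi> i)))\<^sup>2) \<and>
        (\<Sum>\<^sub>\<infinity>i\<in>I. (cmod (L2_inner f (\<phi> i)))\<^sup>2) \<le> B * (L2_norm f)\<^sup>2)"

text \<open>The lattice generated by (1, 0) and (0, \<open>\<beta>\<close>) in the time-frequency plane.\<close>

definition rect_lattice :: "real \<Rightarrow> (real \<times> real) set" where
  "rect_lattice \<beta> = {(of_int k, \<beta> * of_int n) | k n :: int. True}"

text \<open>As usual for frames, a Gabor system is treated as a family indexed by the lattice.\<close>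

definition gabor_system :: "(real \<Rightarrow> complex) \<Rightarrow> real \<times> real \<Rightarrow> real \<Rightarrow> complex" where
  "gabor_system g = (\<lambda>(x, \<xi>). modulation \<xi> (translation x g))"

definition gabor_frame :: "(real \<Rightarrow> complex) \<Rightarrow> (real \<times> real) set \<Rightarrow> bool" where
  "gabor_frame g \<Lambda> \<longleftrightarrow> L2_frame \<Lambda> (gabor_system g)"

end

theory Submission
  imports Defs "HOL-Probability.Characteristic_Functions"
begin

text \<open>If \<open>f\<close> were square integrable, vanishing frame coefficients would contradict the lower frame bound at
once. Here \<open>f\<close> is only quasi-periodic, so it is approximated by the truncations \<open>f\<^sub>N\<close> to \<open>[0, N)\<close>, which
satisfy \<open>\<parallel>f\<^sub>N\<parallel>\<^sup>2 = N E\<close> with \<open>E > 0\<close> the energy of \<open>f\<close> on a unit interval. The lower frame bound fails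
because the squared frame coefficients of \<open>f\<^sub>N\<close> add up to \<open>o(N)\<close>.

The reason is that \<open>f\<close> is orthogonal to every atom of the system: quasi-periodicity carries the
hypothesis at position 0 to all integer positions (\<open>product_orthogonal\<close>). In the coefficient of \<open>f\<^sub>N\<close> at
position \<open>k\<close> the cutoff \<open>\<chi>\<close> can thus be replaced by \<open>\<chi> - \<chi>(k)\<close>, and only pairs of a position \<open>k\<close> and
a unit interval \<open>[j, j + 1)\<close> on opposite sides of an endpoint of \<open>[0, N)\<close> contribute
(\<open>truncation_coeff_tendsto\<close>). Summing over the frequencies \<open>\<beta>n\<close> by the Bessel inequality
(\<open>bessel_on_unit_interval\<close>), each pair costs at most a constant times \<open>w(j - k)\<close>, where \<open>w(m)\<close> bounds
\<open>\<bar>g\<bar>\<close> on \<open>[m, m + 1)\<close> (\<open>truncation_coeff_sum_le\<close>). At most \<open>2 min(\<bar>m\<bar>, N)\<close> separated pairs have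
\<open>j - k = m\<close>, and \<open>\<Sum>\<^sub>m w(m) min(\<bar>m\<bar>, N) = o(N)\<close> as soon as \<open>w\<close> is summable
(\<open>weighted_jumps_sublinear\<close>).

The assumption \<open>g \<in> S0_space\<close> enters through the summability of \<open>w\<close> (\<open>S0_amalgam_bound\<close>): the product of
\<open>g\<close> with the Gaussian centred at \<open>x\<close> has an integrable Fourier transform for almost every \<open>x\<close>, hence is
bounded almost everywhere by the \<open>L\<^sup>1\<close> norm of that transform (\<open>AE_le_integral_fourier\<close>), and these norms are integrable
in \<open>x\<close>.\<close>

section \<open>The Fourier transform and the sup norm\<close>

text \<open>The characteristic function of the standard normal distribution, rescaled, exhibits every centred
normal density as the Fourier integral of a Gaussian with values in \<open>[0, 1]\<close>.\<close>

lemma normal_density_eq_fourier_integral: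
  fixes \<sigma> u :: real
  assumes "\<sigma> > 0"
  shows "integrable lborel (\<lambda>\<xi>. exp (- 2 * (pi * \<sigma> * \<xi>)\<^sup>2))"
    and "complex_of_real (normal_density 0 \<sigma> u) =
      (LBINT \<xi>. of_real (exp (- 2 * (pi * \<sigma> * \<xi>)\<^sup>2)) * cis (2 * pi * \<xi> * u))"
proof -
  have c: "2 * pi * \<sigma> \<noteq> 0" using assms by simp
  have rescale: "std_normal_density (0 + 2 * pi * \<sigma> * \<xi>) = exp (- 2 * (pi * \<sigma> * \<xi>)\<^sup>2) / sqrt (2 * pi)"
    for \<xi> by (simp add: std_normal_density_def power_mult_distrib)
  have "integrable lborel (\<lambda>\<xi>. sqrt (2 * pi) * std_normal_density (0 + 2 * pi * \<sigma> * \<xi>))"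
    by (intro integrable_mult_right lborel_integrable_real_affine integrable_normal_density c zero_less_one)
  then show "integrable lborel (\<lambda>\<xi>. exp (- 2 * (pi * \<sigma> * \<xi>)\<^sup>2))"
    unfolding rescale by simp
  have "complex_of_real (exp (- (u / \<sigma>)\<^sup>2 / 2)) = char std_normal_distribution (u / \<sigma>)"
    by (simp add: char_std_normal_distribution)
  also have "\<dots> = (LBINT y. std_normal_density y *\<^sub>R iexp (u / \<sigma> * y))"
    by (simp add: char_def integral_density)
  also have "\<dots> = (2 * pi * \<sigma>) *\<^sub>R (LBINT \<xi>. std_normal_density (0 + 2 * pi * \<sigma> * \<xi>) *\<^sub>R iexp (u / \<sigma> * (0 + 2 * pi * \<sigma> * \<xi>)))"
    using assms by (subst lborel_integral_real_affine[OF c, of _ 0]) simp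
  also have "(\<lambda>\<xi>. std_normal_density (0 + 2 * pi * \<sigma> * \<xi>) *\<^sub>R iexp (u / \<sigma> * (0 + 2 * pi * \<sigma> * \<xi>))) =
     (\<lambda>\<xi>. of_real (1 / sqrt (2 * pi)) * (of_real (exp (- 2 * (pi * \<sigma> * \<xi>)\<^sup>2)) * cis (2 * pi * \<xi> * u)))"
    unfolding rescale using assms by (auto simp: fun_eq_iff scaleR_conv_of_real cis_conv_exp field_simps)
  finally have *: "complex_of_real (exp (- (u / \<sigma>)\<^sup>2 / 2)) = of_real (2 * pi * \<sigma> / sqrt (2 * pi)) *
      (LBINT \<xi>. of_real (exp (- 2 * (pi * \<sigma> * \<xi>)\<^sup>2)) * cis (2 * pi * \<xi> * u))"
    by (simp add: scaleR_conv_of_real del: of_real_exp)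
  have "complex_of_real (normal_density 0 \<sigma> u) = of_real (1 / (\<sigma> * sqrt (2 * pi))) * of_real (exp (- (u / \<sigma>)\<^sup>2 / 2))"
    using assms by (simp add: normal_density_def real_sqrt_mult power_divide mult_ac)
  also have "\<dots> = of_real (1 / (\<sigma> * sqrt (2 * pi)) * (2 * pi * \<sigma> / sqrt (2 * pi))) *
      (LBINT \<xi>. of_real (exp (- 2 * (pi * \<sigma> * \<xi>)\<^sup>2)) * cis (2 * pi * \<xi> * u))"
    unfolding * by (simp only: of_real_mult mult.assoc)
  also have "1 / (\<sigma> * sqrt (2 * pi)) * (2 * pi * \<sigma> / sqrt (2 * pi)) = 1"
    using assms by (simp add: field_simps)
  finally show "complex_of_real (normal_density 0 \<sigma> u) =
      (LBINT \<xi>. of_real (exp (- 2 * (pi * \<sigma> * \<xi>)\<^sup>2)) * cis (2 * pi * \<xi> * u))" by simp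
qed

lemma integrable_gaussian_mult_cis:
  assumes "\<sigma> > 0"
  shows "integrable lborel (\<lambda>\<xi>. complex_of_real (exp (- 2 * (pi * \<sigma> * \<xi>)\<^sup>2)) * cis (2 * pi * \<xi> * u))"
  by (rule Bochner_Integration.integrable_bound[OF normal_density_eq_fourier_integral(1)[OF assms]])
     (auto simp: norm_mult cis_conv_exp)

definition fourier :: "(real \<Rightarrow> complex) \<Rightarrow> real \<Rightarrow> complex" where
  "fourier F \<xi> = (LBINT t. F t * cis (- 2 * pi * \<xi> * t))"

lemma borel_measurable_cis[measurable]: "cis \<in> borel_measurable borel"
  by (intro borel_measurable_continuous_onI continuous_intros)

lemma borel_measurable_cnj[measurable]: "cnj \<in> borel_measurable borel"
  by (intro borel_measurable_continuous_onI continuous_intros)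

text \<open>Fubini turns the convolution of \<open>F\<close> with a normal density into the Fourier inversion integral
damped by a factor in \<open>[0, 1]\<close>, hence the bound is uniform in the width \<open>\<sigma>\<close>.\<close>

lemma gaussian_mean_le_fourier:
  fixes F :: "real \<Rightarrow> complex"
  assumes F[measurable]: "integrable lborel F" and Fh[measurable]: "integrable lborel (fourier F)"
    and "\<sigma> > 0"
  shows "cmod (LBINT t. F t * of_real (normal_density 0 \<sigma> (x - t))) \<le> (LBINT \<xi>. cmod (fourier F \<xi>))"
proof -
  define E where "E \<xi> = exp (- 2 * (pi * \<sigma> * \<xi>)\<^sup>2)" for \<xi>
  have E[measurable]: "integrable lborel E" and E01: "0 \<le> E \<xi>" "E \<xi> \<le> 1" for \<xi>
    unfolding E_def by (rule normal_density_eq_fourier_integral(1)[OF \<open>\<sigma> > 0\<close>]) auto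
  define H where "H t \<xi> = F t * (of_real (E \<xi>) * cis (2 * pi * \<xi> * (x - t)))" for t \<xi>
  have Hm[measurable]: "case_prod H \<in> borel_measurable (lborel \<Otimes>\<^sub>M lborel)"
    unfolding H_def by measurable
  have nH: "cmod (H t \<xi>) = cmod (F t) * E \<xi>" for t \<xi>
    using E01 by (simp add: H_def norm_mult)
  have "integrable lborel (\<lambda>\<xi>. H t \<xi>)" for t
    unfolding H_def E_def using integrable_gaussian_mult_cis[OF \<open>\<sigma> > 0\<close>] by (rule integrable_mult_right)
  then have int: "integrable (lborel \<Otimes>\<^sub>M lborel) (case_prod H)"
    using F by (intro lborel_pair.Fubini_integrable) (auto simp: nH intro!: integrable_norm integrable_mult_left)
  have "(LBINT t. F t * of_real (normal_density 0 \<sigma> (x - t))) = (LBINT t. LBINT \<xi>. H t \<xi>)"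
    by (simp add: H_def E_def normal_density_eq_fourier_integral(2)[OF \<open>\<sigma> > 0\<close>])
  also have "\<dots> = (LBINT \<xi>. LBINT t. H t \<xi>)"
    by (rule lborel_pair.Fubini_integral[OF int, symmetric])
  also have "\<dots> = (LBINT \<xi>. of_real (E \<xi>) * cis (2 * pi * \<xi> * x) * fourier F \<xi>)"
    unfolding fourier_def integral_mult_right_zero[symmetric]
    by (intro Bochner_Integration.integral_cong refl)
       (simp add: H_def cis_mult algebra_simps)
  also have "cmod \<dots> \<le> (LBINT \<xi>. cmod (of_real (E \<xi>) * cis (2 * pi * \<xi> * x) * fourier F \<xi>))"
    by (rule integral_norm_bound)
  also have "\<dots> \<le> (LBINT \<xi>. cmod (fourier F \<xi>))"
  proof (rule integral_mono)
    show le: "cmod (of_real (E \<xi>) * cis (2 * pi * \<xi> * x) * fourier F \<xi>) \<le> cmod (fourier F \<xi>)" for \<xi>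
      using E01 by (simp add: norm_mult mult_left_le_one_le)
    show "integrable lborel (\<lambda>\<xi>. cmod (fourier F \<xi>))" using Fh by (rule integrable_norm)
    then show "integrable lborel (\<lambda>\<xi>. cmod (of_real (E \<xi>) * cis (2 * pi * \<xi> * x) * fourier F \<xi>))"
      by (rule Bochner_Integration.integrable_bound) (use le in auto)
  qed
  finally show ?thesis .
qed

text \<open>Substituting \<open>x = t + \<sigma> y\<close> moves the width out of the density, so that dominated convergence applies
as \<open>\<sigma>\<close> tends to 0.\<close>

lemma gaussian_mean_indicator:
  fixes a b t \<sigma> :: real
  assumes "\<sigma> > 0"
  shows "(LBINT x. indicator {a..b} x * normal_density 0 \<sigma> (x - t)) =
         (LBINT y. indicator {a..b} (t + \<sigma> * y) * std_normal_density y)"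
proof -
  have "(LBINT x. indicator {a..b} x * normal_density 0 \<sigma> (x - t)) =
      \<sigma> *\<^sub>R (LBINT y. indicator {a..b} (t + \<sigma> * y) * normal_density 0 \<sigma> (\<sigma> * y))"
    using assms by (subst lborel_integral_real_affine[of \<sigma> _ t]) auto
  also have "\<dots> = (LBINT y. indicator {a..b} (t + \<sigma> * y) * std_normal_density y)"
    unfolding integral_scaleR_right[symmetric] using assms
    by (intro Bochner_Integration.integral_cong refl)
       (simp add: normal_density_def real_sqrt_mult power_mult_distrib divide_simps)
  finally show ?thesis .
qed

lemma gaussian_mean_indicator_tendsto:
  fixes a b t :: real
  assumes "t \<noteq> a" "t \<noteq> b"
  shows "(\<lambda>n. LBINT y. indicator {a..b} (t + inverse (real (Suc n)) * y) * std_normal_density y)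
    \<longlonglongrightarrow> indicator {a..b} t"
proof -
  have "(\<lambda>n. LBINT y. indicator {a..b} (t + inverse (real (Suc n)) * y) * std_normal_density y)
    \<longlonglongrightarrow> (LBINT y. indicator {a..b} t * std_normal_density y)"
  proof (rule integral_dominated_convergence[where w = std_normal_density])
    show "AE y in lborel. (\<lambda>n. indicator {a..b} (t + inverse (real (Suc n)) * y) * std_normal_density y)
        \<longlonglongrightarrow> indicator {a..b} t * std_normal_density y"
    proof (intro AE_I2 tendsto_mult tendsto_const)
      fix y :: real
      have lim: "(\<lambda>n. t + inverse (real (Suc n)) * y) \<longlonglongrightarrow> t + 0 * y"
        by (intro tendsto_intros LIMSEQ_inverse_real_of_nat)
      have "t \<in> - {a, b}" using assms by auto
      then have "isCont (indicator {a..b} :: real \<Rightarrow> real) t"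
        using assms by (auto simp: isCont_indicator frontier_def)
      then show "(\<lambda>n. indicator {a..b} (t + inverse (real (Suc n)) * y) :: real) \<longlonglongrightarrow> indicator {a..b} t"
        using lim by (auto intro: isCont_tendsto_compose)
    qed
  qed (auto simp: indicator_def)
  then show ?thesis by simp
qed

text \<open>Averaging the bound on Gaussian means over \<open>x\<close> in \<open>[a, b]\<close> amounts to integrating \<open>F\<close> against a
smoothed indicator of \<open>[a, b]\<close>; letting the width tend to 0 removes the smoothing.\<close>

lemma interval_integral_le_fourier:
  fixes F :: "real \<Rightarrow> complex" and a b :: real
  assumes F[measurable]: "integrable lborel F" and Fh: "integrable lborel (fourier F)" and "a \<le> b"
  shows "cmod (LBINT t:{a..b}. F t) \<le> (LBINT \<xi>. cmod (fourier F \<xi>)) * (b - a)"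
proof -
  define M where "M = (LBINT \<xi>. cmod (fourier F \<xi>))"
  define \<Phi> where "\<Phi> \<sigma> t = (LBINT x. indicator {a..b} x * normal_density 0 \<sigma> (x - t))" for \<sigma> t
  have intI: "integrable lborel (\<lambda>x. indicator {a..b} x * normal_density 0 \<sigma> (x - t))" if "\<sigma> > 0" for \<sigma> t
    by (rule Bochner_Integration.integrable_bound[OF lborel_integrable_real_affine[OF integrable_normal_density[OF that, of 0], of 1 "- t"]])
       (auto simp: indicator_def)
  have \<Phi>: "0 \<le> \<Phi> \<sigma> t" "\<Phi> \<sigma> t \<le> 1" if "\<sigma> > 0" for \<sigma> t
  proof -
    show "0 \<le> \<Phi> \<sigma> t" unfolding \<Phi>_def by (intro integral_nonneg_AE) auto
    have "\<Phi> \<sigma> t \<le> (LBINT x. normal_density 0 \<sigma> (- t + 1 * x))"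
      unfolding \<Phi>_def using intI[OF that] that
      by (intro integral_mono lborel_integrable_real_affine) (auto simp: indicator_def)
    also have "\<dots> = 1"
      using lborel_integral_real_affine[of 1 "normal_density 0 \<sigma>" "- t"] that by simp
    finally show "\<Phi> \<sigma> t \<le> 1" .
  qed
  have mean: "cmod (LBINT t. F t * of_real (\<Phi> \<sigma> t)) \<le> M * (b - a)" if "\<sigma> > 0" for \<sigma>
  proof -
    define H where "H t x = F t * of_real (indicator {a..b} x * normal_density 0 \<sigma> (x - t))" for t x
    have Hm[measurable]: "case_prod H \<in> borel_measurable (lborel \<Otimes>\<^sub>M lborel)"
      unfolding H_def by measurable
    have nH: "cmod (H t x) = cmod (F t) * (indicator {a..b} x * normal_density 0 \<sigma> (x - t))" for t x
      by (simp add: H_def norm_mult)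
    have 1: "integrable lborel (\<lambda>x. H t x)" for t
      unfolding H_def using intI[OF that] by (intro integrable_mult_right integrable_of_real)
    have 2: "integrable lborel (\<lambda>t. LBINT x. cmod (H t x))"
    proof (rule Bochner_Integration.integrable_bound[OF F])
      show "AE t in lborel. norm (LBINT x. cmod (H t x)) \<le> norm (F t)"
        using \<Phi>[OF that] by (simp add: nH \<Phi>_def[symmetric] abs_mult mult_left_le)
    qed measurable
    have int: "integrable (lborel \<Otimes>\<^sub>M lborel) (case_prod H)"
      using 1 2 by (intro lborel_pair.Fubini_integrable) auto
    have "(LBINT t. F t * of_real (\<Phi> \<sigma> t)) = (LBINT t. LBINT x. H t x)"
      by (simp add: H_def \<Phi>_def del: of_real_mult)
    also have "\<dots> = (LBINT x. LBINT t. H t x)"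
      by (rule lborel_pair.Fubini_integral[OF int, symmetric])
    also have "\<dots> = (LBINT x. indicator {a..b} x *\<^sub>R (LBINT t. F t * of_real (normal_density 0 \<sigma> (x - t))))"
      by (intro Bochner_Integration.integral_cong refl) (auto simp: H_def indicator_def)
    also have "cmod \<dots> \<le> (LBINT x. indicator {a..b} x * M)"
    proof (rule Bochner_Integration.integral_norm_bound_integral)
      have "(\<lambda>x. LBINT t. H t x) =
          (\<lambda>x. indicator {a..b} x *\<^sub>R (LBINT t. F t * of_real (normal_density 0 \<sigma> (x - t))))"
        by (auto simp: H_def indicator_def)
      with lborel_pair.integrable_snd[OF int] show "integrable lborel
          (\<lambda>x. indicator {a..b} x *\<^sub>R (LBINT t. F t * of_real (normal_density 0 \<sigma> (x - t))))"
        by simp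
      show "integrable lborel (\<lambda>x. indicator {a..b} x * M)"
        by (intro integrable_mult_left integrable_real_indicator) (auto simp: emeasure_lborel_Icc_eq)
    qed (use gaussian_mean_le_fourier[OF F Fh that] in \<open>auto simp: M_def indicator_def\<close>)
    also have "\<dots> = M * (b - a)" using \<open>a \<le> b\<close> by simp
    finally show ?thesis .
  qed
  have "(\<lambda>n. LBINT t. F t * of_real (\<Phi> (inverse (real (Suc n))) t)) \<longlonglongrightarrow> (LBINT t. F t * of_real (indicator {a..b} t))"
  proof (rule integral_dominated_convergence[where w = "\<lambda>t. cmod (F t)"])
    have "AE t in lborel. t \<noteq> a" "AE t in lborel. t \<noteq> b" by (rule AE_lborel_singleton)+
    then show "AE t in lborel. (\<lambda>n. F t * of_real (\<Phi> (inverse (real (Suc n))) t)) \<longlonglongrightarrow> F t * of_real (indicator {a..b} t)"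
    proof eventually_elim
      case (elim t)
      show ?case
        using gaussian_mean_indicator_tendsto[OF elim]
        by (intro tendsto_intros) (simp add: \<Phi>_def gaussian_mean_indicator)
    qed
    show "AE t in lborel. norm (F t * of_real (\<Phi> (inverse (real (Suc n))) t)) \<le> cmod (F t)" for n
      using \<Phi>[of "inverse (real (Suc n))"] by (auto simp: norm_mult mult_left_le)
  qed (use F in \<open>auto simp: \<Phi>_def\<close>)
  then have "cmod (LBINT t. F t * of_real (indicator {a..b} t)) \<le> M * (b - a)"
    using mean by (intro LIMSEQ_le_const2[OF tendsto_norm]) auto
  then show ?thesis
    by (simp add: M_def set_lebesgue_integral_def scaleR_conv_of_real mult.commute)
qed

text \<open>Divide the bound on interval integrals by the length of the interval and differentiate almost
everywhere.\<close>

theorem AE_le_integral_fourier: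
  fixes F :: "real \<Rightarrow> complex"
  assumes F: "integrable lborel F" and Fh: "integrable lborel (fourier F)"
  shows "AE t in lborel. cmod (F t) \<le> (LBINT \<xi>. cmod (fourier F \<xi>))"
proof -
  define M where "M = (LBINT \<xi>. cmod (fourier F \<xi>))"
  have int: "set_integrable lborel {a..b} F" for a b
    unfolding set_integrable_def by (rule integrable_mult_indicator) (use F in auto)
  have "F integrable_on cbox a b" for a b
    using set_borel_integral_eq_integral(1)[OF int] by simp
  then obtain N where N: "negligible N"
    and lim: "\<And>x e. \<lbrakk>x \<notin> N; 0 < e\<rbrakk> \<Longrightarrow> \<exists>d>0. \<forall>h. 0 < h \<and> h < d \<longrightarrow>
        norm (integral (cbox x (x + h *\<^sub>R One)) F /\<^sub>R h ^ DIM(real) - F x) < e"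
    using integrable_ccontinuous_explicit[of F] by blast
  have le: "cmod (F x) \<le> M" if "x \<notin> N" for x
  proof (rule field_le_epsilon)
    fix e :: real assume "0 < e"
    from lim[OF that this] obtain d where "d > 0" and
      d: "\<And>h. 0 < h \<Longrightarrow> h < d \<Longrightarrow> norm (integral (cbox x (x + h *\<^sub>R One)) F /\<^sub>R h ^ DIM(real) - F x) < e"
      by blast
    define h where "h = d / 2"
    have h: "0 < h" "h < d" using \<open>d > 0\<close> by (auto simp: h_def)
    have "cmod (integral {x..x + h} F) \<le> M * h"
      using interval_integral_le_fourier[OF F Fh, of x "x + h"] h set_borel_integral_eq_integral(2)[OF int, of x "x + h"]
      by (simp add: M_def)
    then have "cmod (integral {x..x + h} F /\<^sub>R h) \<le> M"
      using h by (simp add: field_simps)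
    moreover have "cmod (integral {x..x + h} F /\<^sub>R h - F x) < e"
      using d[OF h] by simp
    ultimately show "cmod (F x) \<le> M + e"
      using norm_triangle_ineq2[of "F x" "integral {x..x + h} F /\<^sub>R h"] by (simp add: norm_minus_commute)
  qed
  have "N \<in> null_sets lebesgue" using N by (simp add: negligible_iff_null_sets)
  then have "AE t in lebesgue. t \<notin> N" by (rule AE_not_in)
  then have "AE t in lebesgue. cmod (F t) \<le> M" using le by (rule eventually_mono)
  then show ?thesis unfolding M_def by (simp add: AE_completion_iff)
qed

section \<open>Functions in the Feichtinger algebra lie in a Wiener amalgam space\<close>

lemma AE_eq_borel_complex:
  fixes g :: "real \<Rightarrow> complex"
  assumes "g \<in> borel_measurable lebesgue"
  obtains g' where "g' \<in> borel_measurable borel" "AE t in lborel. g t = g' t"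
proof -
  have "(\<lambda>t. Re (g t)) \<in> borel_measurable lebesgue" "(\<lambda>t. Im (g t)) \<in> borel_measurable lebesgue"
    using assms by measurable
  then obtain r i where [measurable]: "r \<in> borel_measurable borel" "i \<in> borel_measurable borel"
    and r: "AE t in lborel. Re (g t) = r t" and i: "AE t in lborel. Im (g t) = i t"
    by (auto dest!: completion_ex_borel_measurable_real)
  show ?thesis
  proof
    show "(\<lambda>t. Complex (r t) (i t)) \<in> borel_measurable borel"
      by (simp add: Complex_eq) measurable
    show "AE t in lborel. g t = Complex (r t) (i t)"
      using r i by eventually_elim (simp add: complex_eq_iff)
  qed
qed

text \<open>Fubini on the time-frequency plane needs a short-time Fourier transform that is Borel measurable in
both variables jointly. Replacing \<open>g\<close> by a Borel representative leaves the transform unchanged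
at every point and makes it the Fourier transform of the function multiplied by a shifted Gaussian.\<close>

lemma S0_space_borel_representative:
  fixes g :: "real \<Rightarrow> complex"
  assumes "g \<in> S0_space"
  obtains g' where "g' \<in> borel_measurable borel" "AE t in lborel. g t = g' t"
    "integrable lborel (\<lambda>t. (cmod (g' t))\<^sup>2)"
    "integrable (lborel \<Otimes>\<^sub>M lborel)
       (\<lambda>(x, \<xi>). fourier (\<lambda>t. g' t * gauss_window (t - x)) \<xi>)"
proof -
  have gm: "g \<in> borel_measurable lebesgue" and g2: "integrable lebesgue (\<lambda>t. (cmod (g t))\<^sup>2)"
    and V: "integrable lebesgue (\<lambda>(x, \<xi>). stft gauss_window g x \<xi>)"
    using assms by (auto simp: S0_space_def L2_space_def)
  obtain g' where [measurable]: "g' \<in> borel_measurable borel" and ae: "AE t in lborel. g t = g' t"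
    using AE_eq_borel_complex[OF gm] .
  have ae': "AE t in lebesgue. g t = g' t" using ae by (rule AE_completion)
  have [measurable]: "gauss_window \<in> borel_measurable borel"
    unfolding gauss_window_def[abs_def] by measurable
  have "integrable lebesgue (\<lambda>t. (cmod (g' t))\<^sup>2)"
    by (rule integrable_cong_AE_imp[OF g2]) (use ae' in \<open>auto elim: eventually_mono intro: measurable_completion\<close>)
  then have 1: "integrable lborel (\<lambda>t. (cmod (g' t))\<^sup>2)"
    by (subst (asm) integrable_completion) auto
  have eq: "stft gauss_window g x \<xi> = fourier (\<lambda>t. g' t * gauss_window (t - x)) \<xi>" for x \<xi>
  proof -
    have "stft gauss_window g x \<xi> = (LINT t|lebesgue. g' t * gauss_window (t - x) * cis (- 2 * pi * \<xi> * t))"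
      unfolding stft_def
    proof (rule integral_cong_AE)
      show "AE t in lebesgue. g t * cnj (gauss_window (t - x)) * cis (- 2 * pi * \<xi> * t) =
          g' t * gauss_window (t - x) * cis (- 2 * pi * \<xi> * t)"
        using ae' by (auto elim: eventually_mono simp: gauss_window_def)
      have "(\<lambda>t. cnj (gauss_window (t - x)) * cis (- 2 * pi * \<xi> * t)) \<in> borel_measurable lebesgue"
        by (rule measurable_completion) measurable
      with gm show "(\<lambda>t. g t * cnj (gauss_window (t - x)) * cis (- 2 * pi * \<xi> * t)) \<in> borel_measurable lebesgue"
        unfolding mult.assoc by (rule borel_measurable_times)
      show "(\<lambda>t. g' t * gauss_window (t - x) * cis (- 2 * pi * \<xi> * t)) \<in> borel_measurable lebesgue"
        by (rule measurable_completion) measurable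
    qed
    also have "\<dots> = fourier (\<lambda>t. g' t * gauss_window (t - x)) \<xi>"
      unfolding fourier_def by (rule integral_completion) measurable
    finally show ?thesis .
  qed
  have "integrable (lborel :: (real \<times> real) measure) (\<lambda>(x, \<xi>). fourier (\<lambda>t. g' t * gauss_window (t - x)) \<xi>)"
  proof -
    have "(\<lambda>(x, \<xi>). fourier (\<lambda>t. g' t * gauss_window (t - x)) \<xi>) \<in> borel_measurable (lborel \<Otimes>\<^sub>M lborel)"
      unfolding fourier_def by measurable
    then show ?thesis
      using V unfolding eq lborel_prod by (subst (asm) integrable_completion)
  qed
  then show thesis
    using that[OF _ ae 1] by (simp add: lborel_prod)
qed

text \<open>The inclusion of \<open>S0_space\<close> into the amalgam space of functions that are locally bounded with summable
local bounds. By the Fourier bound, \<open>\<bar>g t\<bar>\<close> times the Gaussian centred at \<open>x\<close> is at most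
\<open>G x\<close>, the integral of the modulus of the short-time Fourier transform over all frequencies, for almost all \<open>x\<close> and
\<open>t\<close>. The Gaussian is bounded below for \<open>x\<close> in the unit interval containing \<open>t\<close>, and integration over
such \<open>x\<close> bounds \<open>\<bar>g t\<bar>\<close> by a multiple of the integral of \<open>G\<close> over that interval. These integrals
add up to the integral of \<open>G\<close>.\<close>

lemma S0_amalgam_bound:
  fixes g :: "real \<Rightarrow> complex"
  assumes "g \<in> S0_space"
  obtains w :: "int \<Rightarrow> real" where "\<And>m. w m > 0" "w summable_on UNIV"
    "AE t in lebesgue. cmod (g t) \<le> w \<lfloor>t\<rfloor>"
proof -
  obtain g' where [measurable]: "g' \<in> borel_measurable borel" and ae: "AE t in lborel. g t = g' t"
    and g2: "integrable lborel (\<lambda>t. (cmod (g' t))\<^sup>2)"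
    and V: "integrable (lborel \<Otimes>\<^sub>M lborel)
       (\<lambda>(x, \<xi>). fourier (\<lambda>t. g' t * gauss_window (t - x)) \<xi>)"
    using S0_space_borel_representative[OF assms] .
  have [measurable]: "gauss_window \<in> borel_measurable borel"
    unfolding gauss_window_def[abs_def] by measurable
  define G where "G x = (LBINT \<xi>. cmod (fourier (\<lambda>t. g' t * gauss_window (t - x)) \<xi>))" for x
  have Gm[measurable]: "G \<in> borel_measurable borel" unfolding G_def fourier_def by measurable
  have Gint: "integrable lborel G"
    unfolding G_def using integrable_norm[OF V] by (intro lborel_pair.integrable_fst) (simp add: case_prod_unfold)
  have Gpos: "0 \<le> G x" for x unfolding G_def by (intro integral_nonneg_AE) auto
  have F: "integrable lborel (\<lambda>t. g' t * gauss_window (t - x))" for x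
  proof -
    have "integrable lborel (\<lambda>t. exp (- 2 * (pi * (1 / sqrt pi) * (- x + 1 * t))\<^sup>2))"
      by (intro lborel_integrable_real_affine normal_density_eq_fourier_integral(1)) auto
    then have "integrable lborel (\<lambda>t. sqrt 2 * exp (- 2 * pi * (t - x)\<^sup>2))"
      by (intro integrable_mult_right) (simp add: power_mult_distrib power_divide power2_eq_square[of pi] mult.assoc)
    also have "(\<lambda>t. sqrt 2 * exp (- 2 * pi * (t - x)\<^sup>2)) = (\<lambda>t. (cmod (gauss_window (t - x)))\<^sup>2)"
    proof
      fix t
      have "(2 powr (1/4))\<^sup>2 = sqrt (2::real)"
        by (simp add: powr_half_sqrt[symmetric] power2_eq_square powr_add[symmetric])
      then show "sqrt 2 * exp (- 2 * pi * (t - x)\<^sup>2) = (cmod (gauss_window (t - x)))\<^sup>2"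
        by (simp add: gauss_window_def norm_mult power_mult_distrib exp_double[symmetric])
    qed
    finally have "integrable lborel (\<lambda>t. (cmod (g' t))\<^sup>2 + (cmod (gauss_window (t - x)))\<^sup>2)"
      using g2 by (rule Bochner_Integration.integrable_add[rotated])
    then show ?thesis
    proof (rule Bochner_Integration.integrable_bound)
      have "cmod (g' t * gauss_window (t - x)) \<le> (cmod (g' t))\<^sup>2 + (cmod (gauss_window (t - x)))\<^sup>2" for t
      proof -
        have "0 \<le> cmod (g' t) * cmod (gauss_window (t - x))" by simp
        then show ?thesis
          using sum_squares_bound[of "cmod (g' t)" "cmod (gauss_window (t - x))"]
          unfolding norm_mult mult.assoc by linarith
      qed
      then show "AE t in lborel. norm (g' t * gauss_window (t - x))
          \<le> norm ((cmod (g' t))\<^sup>2 + (cmod (gauss_window (t - x)))\<^sup>2)"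
        by (intro AE_I2) (simp add: abs_of_nonneg)
    qed measurable
  qed
  have "AE x in lborel. AE t in lborel. cmod (g' t * gauss_window (t - x)) \<le> G x"
    using lborel_pair.AE_integrable_fst[OF V]
    by eventually_elim (use AE_le_integral_fourier[OF F] in \<open>simp add: G_def\<close>)
  then have swapped: "AE t in lborel. AE x in lborel. cmod (g' t * gauss_window (t - x)) \<le> G x"
    by (subst (asm) lborel_pair.AE_commute) measurable
  \<comment> \<open>The minimum of the Gaussian over \<open>[-1, 1]\<close>, where the difference of two points of a unit interval lies.\<close>
  define c where "c = 2 powr (1/4) * exp (- pi)"
  have "c > 0" by (simp add: c_def)
  define I where "I m = {real_of_int m..<real_of_int m + 1}" for m
  define u where "u m = (LBINT x:I m. G x) / c" for m
  have Gset: "set_integrable lborel A G" if "A \<in> sets borel" for A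
    unfolding set_integrable_def using that Gint by (intro integrable_mult_indicator) auto
  have upos: "0 \<le> u m" for m
    unfolding u_def set_lebesgue_integral_def using Gpos \<open>c > 0\<close>
    by (intro divide_nonneg_pos integral_nonneg_AE) auto
  have gu: "AE t in lborel. cmod (g' t) \<le> u \<lfloor>t\<rfloor>"
    using swapped
  proof eventually_elim
    case (elim t)
    have "(LBINT x:I \<lfloor>t\<rfloor>. cmod (g' t) * c) \<le> (LBINT x:I \<lfloor>t\<rfloor>. G x)"
    proof (rule set_integral_mono_AE)
      show "set_integrable lborel (I \<lfloor>t\<rfloor>) (\<lambda>x. cmod (g' t) * c)"
        by (simp add: set_integrable_def I_def)
      show "AE x\<in>I \<lfloor>t\<rfloor> in lborel. cmod (g' t) * c \<le> G x"
        using elim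
      proof eventually_elim
        case (elim x)
        show ?case
        proof
          assume "x \<in> I \<lfloor>t\<rfloor>"
          then have "\<bar>t - x\<bar> \<le> 1" unfolding I_def by (auto simp: abs_le_iff) linarith+
          then have "(t - x)\<^sup>2 \<le> 1" by (simp add: abs_square_le_1)
          then have "c \<le> cmod (gauss_window (t - x))"
            by (simp add: c_def gauss_window_def norm_mult mult_left_le)
          then have "cmod (g' t) * c \<le> cmod (g' t * gauss_window (t - x))"
            by (simp add: norm_mult mult_left_mono)
          with elim show "cmod (g' t) * c \<le> G x" by linarith
        qed
      qed
    qed (auto simp: Gset I_def)
    then show ?case using \<open>c > 0\<close> by (simp add: u_def I_def set_lebesgue_integral_def field_simps)
  qed
  have bdd: "sum u M \<le> (LBINT x. G x) / c" if "finite M" for M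
  proof -
    have "(\<Sum>m\<in>M. LBINT x:I m. G x) = (LBINT x:(\<Union>m\<in>M. I m). G x)"
    proof (rule set_integral_finite_Union[symmetric])
      show "disjoint_family_on I M"
        unfolding disjoint_family_on_def I_def by (auto simp: floor_eq_iff[symmetric])
    qed (use that in \<open>auto simp: Gset I_def\<close>)
    also have "\<dots> \<le> (LBINT x. G x)"
      unfolding set_lebesgue_integral_def using Gset[of "\<Union>m\<in>M. I m"] Gint Gpos that
      by (intro integral_mono) (auto simp: indicator_def set_integrable_def I_def)
    finally show ?thesis
      unfolding u_def sum_divide_distrib[symmetric] using \<open>c > 0\<close> by (simp add: divide_right_mono)
  qed
  have "u summable_on UNIV"
    using bdd upos
    by (intro nonneg_bounded_partial_sums_imp_summable_on[where C = "(LBINT x. G x) / c"])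
       (auto intro: eventually_finite_subsets_at_top_weakI)
  \<comment> \<open>A strictly positive summable sequence, added because the weights serve as divisors later.\<close>
  moreover obtain v :: "int \<Rightarrow> real" where v: "\<And>m. v m > 0" "v summable_on UNIV"
  proof
    let ?v = "\<lambda>m::int. (1/2 :: real) ^ nat \<bar>m\<bar>"
    have "summable (\<lambda>n. norm ((1/2 :: real) ^ n))" by simp
    then have geo: "(\<lambda>n. (1/2 :: real) ^ n) summable_on UNIV" by (rule norm_summable_imp_summable_on)
    have "?v summable_on (int ` UNIV)"
      using geo by (subst summable_on_reindex) (auto simp: o_def)
    moreover have "?v summable_on ((\<lambda>n. - int n) ` UNIV)"
      using geo by (subst summable_on_reindex) (auto simp: o_def inj_on_def)
    ultimately have "?v summable_on (int ` UNIV \<union> (\<lambda>n. - int n) ` UNIV)"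
      by (rule summable_on_union)
    moreover have "m \<in> int ` UNIV \<union> (\<lambda>n. - int n) ` UNIV" for m
      by (cases m rule: int_cases2) auto
    ultimately show "?v summable_on UNIV" by (metis UNIV_eq_I)
  qed auto
  ultimately have "(\<lambda>m. u m + v m) summable_on UNIV" by (intro summable_on_add)
  moreover have "AE t in lborel. cmod (g t) \<le> u \<lfloor>t\<rfloor> + v \<lfloor>t\<rfloor>"
    using gu ae by eventually_elim (simp add: add_increasing2 less_imp_le v)
  then have "AE t in lebesgue. cmod (g t) \<le> u \<lfloor>t\<rfloor> + v \<lfloor>t\<rfloor>" by (rule AE_completion)
  moreover have "u m + v m > 0" for m using upos[of m] v(1)[of m] by simp
  ultimately show thesis using that[of "\<lambda>m. u m + v m"] by blast
qed

section \<open>Bessel inequality for exponentials\<close>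

lemma weighted_cauchy_schwarz:
  fixes z :: "'a \<Rightarrow> complex" and v :: "'a \<Rightarrow> real"
  assumes "\<And>j. j \<in> J \<Longrightarrow> v j > 0"
  shows "(cmod (\<Sum>j\<in>J. z j))\<^sup>2 \<le> (\<Sum>j\<in>J. v j) * (\<Sum>j\<in>J. (cmod (z j))\<^sup>2 / v j)"
proof -
  have "(cmod (\<Sum>j\<in>J. z j))\<^sup>2 \<le> (\<Sum>j\<in>J. cmod (z j))\<^sup>2"
    by (intro power_mono norm_sum norm_ge_zero)
  also have "(\<Sum>j\<in>J. cmod (z j)) = (\<Sum>j\<in>J. sqrt (v j) * (cmod (z j) / sqrt (v j)))"
    using assms by (intro sum.cong refl) (simp add: less_imp_neq[symmetric])
  also have "\<dots>\<^sup>2 \<le> (\<Sum>j\<in>J. (sqrt (v j))\<^sup>2) * (\<Sum>j\<in>J. (cmod (z j) / sqrt (v j))\<^sup>2)"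
    by (rule Cauchy_Schwarz_ineq_sum)
  also have "\<dots> = (\<Sum>j\<in>J. v j) * (\<Sum>j\<in>J. (cmod (z j))\<^sup>2 / v j)"
    using assms by (intro arg_cong2[of _ _ _ _ "(*)"] sum.cong refl) (auto simp: power_divide less_imp_le)
  finally show ?thesis .
qed

lemma borel_measurable_lebesgue_cis[measurable]: "(\<lambda>t. cis (c * t)) \<in> borel_measurable lebesgue"
  by (intro measurable_completion) (simp add: borel_measurable_continuous_onI continuous_intros)

lemma integrable_mult_cis:
  assumes "integrable lebesgue H"
  shows "integrable lebesgue (\<lambda>t. H t * cis (c * t))"
  using assms by (rule Bochner_Integration.integrable_bound) (use assms in \<open>auto simp: norm_mult\<close>)

lemma integrable_cis_interval:
  fixes c a b :: real
  shows "integrable lebesgue (\<lambda>t. of_bool (t \<in> {a..b}) * cis (c * t))"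
proof (rule integrable_mult_cis)
  have "integrable lborel (\<lambda>t. complex_of_real (indicator {a..b} t))"
    by (intro integrable_of_real integrable_real_indicator) (auto simp: emeasure_lborel_Icc_eq)
  then have "integrable lebesgue (\<lambda>t. complex_of_real (indicator {a..b} t))"
    by (subst integrable_completion) auto
  also have "(\<lambda>t. complex_of_real (indicator {a..b} t)) = (\<lambda>t. of_bool (t \<in> {a..b}))"
    by (auto simp: fun_eq_iff indicator_def)
  finally show "integrable lebesgue (\<lambda>t. of_bool (t \<in> {a..b}) :: complex)" .
qed

lemma integral_cis_period:
  fixes \<beta> a :: real and k :: int
  assumes "\<beta> > 0"
  shows "(LINT t|lebesgue. of_bool (t \<in> {a..a + 1/\<beta>}) * cis (2 * pi * (\<beta> * of_int k) * t)) =
     (if k = 0 then of_real (1 / \<beta>) else 0)"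
proof -
  have le: "a \<le> a + 1 / \<beta>" using assms by simp
  have "(LINT t|lebesgue. of_bool (t \<in> {a..a + 1/\<beta>}) * cis (2 * pi * (\<beta> * of_int k) * t)) =
    (LBINT t. of_bool (t \<in> {a..a + 1/\<beta>}) * cis (2 * pi * (\<beta> * of_int k) * t))"
    by (rule integral_completion) measurable
  also have "\<dots> = (LBINT t. indicator {a..a + 1/\<beta>} t *\<^sub>R cis (2 * pi * (\<beta> * of_int k) * t))"
    by (intro Bochner_Integration.integral_cong) (auto simp: indicator_def)
  also have "\<dots> = (if k = 0 then of_real (1 / \<beta>) else 0)"
  proof (cases "k = 0")
    case True
    have "(LBINT t. indicator {a..a + 1/\<beta>} t *\<^sub>R (1 :: complex)) = (LBINT t. indicator {a..a + 1/\<beta>} t) *\<^sub>R 1"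
      by (rule integral_scaleR_left) (auto intro: integrable_real_indicator simp: emeasure_lborel_Icc_eq)
    then show ?thesis using True le by (simp add: scaleR_conv_of_real)
  next
    case False
    define c where "c = 2 * pi * (\<beta> * of_int k)"
    have "c \<noteq> 0" using False assms by (simp add: c_def)
    have "(LBINT t. indicator {a..a + 1/\<beta>} t *\<^sub>R cis (c * t)) =
        cis (c * (a + 1/\<beta>)) / (\<i> * c) - cis (c * a) / (\<i> * c)"
    proof (rule integral_FTC_Icc[OF le])
      fix x
      have "((\<lambda>z. exp (\<i> * of_real c * z) / (\<i> * of_real c)) has_field_derivative cis (c * x)) (at (of_real x))"
        using \<open>c \<noteq> 0\<close> by (auto intro!: derivative_eq_intros simp: cis_conv_exp mult_ac)
      then show "((\<lambda>t. cis (c * t) / (\<i> * of_real c)) has_vector_derivative cis (c * x)) (at x within {a..a + 1/\<beta>})"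
        by (drule_tac has_vector_derivative_real_field) (simp add: cis_conv_exp mult_ac)
    qed (intro continuous_intros)
    also have "cis (c * (a + 1/\<beta>)) = cis (c * a) * cis (2 * pi * of_int k)"
    proof -
      have "c * (a + 1/\<beta>) = c * a + 2 * pi * of_int k"
        using assms by (simp add: c_def distrib_left)
      then show ?thesis by (simp only: cis_mult)
    qed
    also have "cis (2 * pi * of_int k) = 1" by (simp add: cis_multiple_2pi)
    finally show ?thesis using False by (simp add: c_def)
  qed
  finally show ?thesis .
qed

text \<open>On an interval of length \<open>1/\<beta>\<close> the exponentials of frequencies \<open>\<beta>n\<close> are orthogonal with squared norm
\<open>1/\<beta>\<close>, so \<open>P\<close> in the proof is the orthogonal projection of \<open>H\<close> onto the span of those with \<open>n\<close> in \<open>N\<close>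
and the claim is that the distance from \<open>H\<close> to \<open>P\<close> has a nonnegative square.\<close>

lemma bessel_on_period:
  fixes H :: "real \<Rightarrow> complex" and \<beta> a :: real and N :: "int set"
  assumes "\<beta> > 0" and H: "integrable lebesgue H" and H2: "integrable lebesgue (\<lambda>t. (cmod (H t))\<^sup>2)"
    and supp: "\<And>t. t \<notin> {a..a + 1/\<beta>} \<Longrightarrow> H t = 0" and "finite N"
  shows "(\<Sum>n\<in>N. (cmod (LINT t|lebesgue. H t * cis (- 2 * pi * (\<beta> * of_int n) * t)))\<^sup>2)
     \<le> 1 / \<beta> * (LINT t|lebesgue. (cmod (H t))\<^sup>2)"
proof -
  define D where "D t = (of_bool (t \<in> {a..a + 1/\<beta>}) :: complex)" for t
  define e where "e n t = cis (2 * pi * (\<beta> * of_int n) * t)" for n :: int and t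
  define c where "c n = (LINT t|lebesgue. H t * cis (- 2 * pi * (\<beta> * of_int n) * t))" for n :: int
  define S where "S = (\<Sum>n\<in>N. (cmod (c n))\<^sup>2)"
  define P where "P t = of_real \<beta> * (\<Sum>n\<in>N. c n * (D t * e n t))" for t
  have cnje: "cnj (e n t) = cis (- 2 * pi * (\<beta> * of_int n) * t)" for n t
    by (simp add: e_def cis_cnj)
  have ee: "e n t * cnj (e m t) = e (n - m) t" for n m t
    by (simp add: cnje) (simp add: e_def cis_mult algebra_simps)
  have DD: "D t * cnj (D t) = D t" "H t * cnj (D t) = H t" for t
    using supp[of t] by (auto simp: D_def)
  have HP: "H t * cnj (P t) = (\<Sum>n\<in>N. of_real \<beta> * cnj (c n) * (H t * cis (- 2 * pi * (\<beta> * of_int n) * t)))" for t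
  proof -
    have "H t * cnj (P t) = (\<Sum>n\<in>N. of_real \<beta> * cnj (c n) * ((H t * cnj (D t)) * cnj (e n t)))"
      by (simp add: P_def cnj_sum sum_distrib_left mult_ac)
    then show ?thesis by (simp only: DD cnje)
  qed
  have PP: "P t * cnj (P t) = (\<Sum>n\<in>N. \<Sum>m\<in>N. of_real (\<beta>\<^sup>2) * (c n * cnj (c m)) * (D t * e (n - m) t))" for t
  proof -
    have "P t * cnj (P t) = of_real (\<beta>\<^sup>2) * ((\<Sum>n\<in>N. c n * (D t * e n t)) * (\<Sum>m\<in>N. cnj (c m * (D t * e m t))))"
      by (simp add: P_def cnj_sum power2_eq_square mult_ac)
    also have "\<dots> = (\<Sum>n\<in>N. \<Sum>m\<in>N. of_real (\<beta>\<^sup>2) * (c n * cnj (c m)) * ((D t * cnj (D t)) * (e n t * cnj (e m t))))"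
      unfolding sum_product unfolding sum_distrib_left by (intro sum.cong refl) (simp add: mult_ac)
    finally show ?thesis by (simp only: DD ee)
  qed
  have intHe: "integrable lebesgue (\<lambda>t. H t * cis (- 2 * pi * (\<beta> * of_int n) * t))" for n :: int
    using H by (rule integrable_mult_cis)
  have intDe: "integrable lebesgue (\<lambda>t. D t * e n t)" for n
    unfolding D_def e_def by (rule integrable_cis_interval)
  have intHP: "integrable lebesgue (\<lambda>t. H t * cnj (P t))"
    unfolding HP by (intro Bochner_Integration.integrable_sum integrable_mult_right intHe)
  have intPP: "integrable lebesgue (\<lambda>t. P t * cnj (P t))"
    unfolding PP by (intro Bochner_Integration.integrable_sum integrable_mult_right intDe)
  have iHP: "(LINT t|lebesgue. H t * cnj (P t)) = of_real (\<beta> * S)"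
  proof -
    have "(LINT t|lebesgue. H t * cnj (P t)) = (\<Sum>n\<in>N. of_real \<beta> * cnj (c n) * c n)"
      unfolding HP c_def
      by (subst Bochner_Integration.integral_sum)
         (intro integrable_mult_right intHe, simp only: integral_mult_right_zero)
    also have "\<dots> = of_real (\<beta> * S)"
      by (simp add: S_def sum_distrib_left complex_norm_square mult_ac del: of_real_power)
    finally show ?thesis .
  qed
  have iPP: "(LINT t|lebesgue. P t * cnj (P t)) = of_real (\<beta> * S)"
  proof -
    have "(LINT t|lebesgue. P t * cnj (P t)) =
        (\<Sum>n\<in>N. \<Sum>m\<in>N. of_real (\<beta>\<^sup>2) * (c n * cnj (c m)) * (LINT t|lebesgue. D t * e (n - m) t))"
      unfolding PP by (simp add: Bochner_Integration.integral_sum Bochner_Integration.integrable_sum intDe)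
    also have "\<dots> = (\<Sum>n\<in>N. \<Sum>m\<in>N. if n = m then of_real \<beta> * (c n * cnj (c m)) else 0)"
      using \<open>\<beta> > 0\<close> unfolding D_def e_def integral_cis_period[OF \<open>\<beta> > 0\<close>]
      by (intro sum.cong refl) (auto simp: power2_eq_square)
    also have "\<dots> = of_real (\<beta> * S)"
      using \<open>finite N\<close> by (simp add: S_def sum_distrib_left complex_norm_square del: of_real_power)
    finally show ?thesis .
  qed
  have split: "(cmod (H t - P t))\<^sup>2 = (cmod (H t))\<^sup>2 - 2 * Re (H t * cnj (P t)) + Re (P t * cnj (P t))" for t
    unfolding cmod_power2 by (simp add: power2_eq_square algebra_simps)
  have "0 \<le> (LINT t|lebesgue. (cmod (H t - P t))\<^sup>2)" by (intro integral_nonneg_AE) auto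
  also have "\<dots> = (LINT t|lebesgue. (cmod (H t))\<^sup>2) - 2 * Re (LINT t|lebesgue. H t * cnj (P t)) + Re (LINT t|lebesgue. P t * cnj (P t))"
    unfolding split
    by (simp only: Bochner_Integration.integral_add[OF Bochner_Integration.integrable_diff[OF H2 integrable_mult_right[OF integrable_Re[OF intHP]]] integrable_Re[OF intPP]]
        Bochner_Integration.integral_diff[OF H2 integrable_mult_right[OF integrable_Re[OF intHP]]]
        integral_mult_right_zero integral_Re[OF intHP] integral_Re[OF intPP])
  also have "\<dots> = (LINT t|lebesgue. (cmod (H t))\<^sup>2) - \<beta> * S"
    unfolding iHP iPP by simp
  finally have "S \<le> 1 / \<beta> * (LINT t|lebesgue. (cmod (H t))\<^sup>2)"
    using \<open>\<beta> > 0\<close> by (simp add: field_simps)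
  then show ?thesis unfolding S_def c_def .
qed

lemma measurable_floor_affine_lebesgue[measurable]:
  "(\<lambda>t. \<lfloor>c * (t - d)\<rfloor>) \<in> lebesgue \<rightarrow>\<^sub>M count_space UNIV" for c d :: real
  by (rule measurable_completion) measurable

text \<open>For \<open>\<beta> > 1\<close> a unit interval is longer than a period. It is cut into \<open>\<lceil>\<beta>\<rceil>\<close> pieces, each of length at
most \<open>1/\<beta>\<close>, and the coefficients of the pieces are recombined by Cauchy-Schwarz.\<close>

lemma bessel_on_unit_interval:
  fixes H :: "real \<Rightarrow> complex" and \<beta> a :: real and N :: "int set"
  assumes "\<beta> > 0" and H: "integrable lebesgue H" and H2: "integrable lebesgue (\<lambda>t. (cmod (H t))\<^sup>2)"
    and supp: "\<And>t. t \<notin> {a..<a + 1} \<Longrightarrow> H t = 0" and "finite N"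
  shows "(\<Sum>n\<in>N. (cmod (LINT t|lebesgue. H t * cis (- 2 * pi * (\<beta> * of_int n) * t)))\<^sup>2)
     \<le> of_int \<lceil>\<beta>\<rceil> / \<beta> * (LINT t|lebesgue. (cmod (H t))\<^sup>2)"
proof -
  define p where "p = \<lceil>\<beta>\<rceil>"
  have p: "p > 0" "\<beta> \<le> p" using \<open>\<beta> > 0\<close> by (auto simp: p_def)
  define I where "I = {0..<p}"
  define h where "h i t = (of_bool (\<lfloor>of_int p * (t - a)\<rfloor> = i) * H t)" for i t
  define c where "c i n = (LINT t|lebesgue. h i t * cis (- 2 * pi * (\<beta> * of_int n) * t))" for i and n :: int
  have [measurable]: "H \<in> borel_measurable lebesgue" using H by auto
  have hm[measurable]: "h i \<in> borel_measurable lebesgue" for i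
    unfolding h_def[abs_def] by measurable
  have h: "integrable lebesgue (h i)" for i
    by (rule Bochner_Integration.integrable_bound[OF H]) (auto simp: h_def)
  have h2: "integrable lebesgue (\<lambda>t. (cmod (h i t))\<^sup>2)" for i
    by (rule Bochner_Integration.integrable_bound[OF H2]) (auto simp: h_def)
  have inI: "\<lfloor>of_int p * (t - a)\<rfloor> \<in> I" if "H t \<noteq> 0" for t
  proof -
    have "t \<in> {a..<a + 1}" using supp that by blast
    then have "0 \<le> of_int p * (t - a)" "of_int p * (t - a) < of_int p * 1"
      using p by (auto intro!: mult_strict_left_mono)
    then show ?thesis unfolding I_def by (auto simp: floor_less_iff)
  qed
  have Hsum: "H t = (\<Sum>i\<in>I. h i t)" for t
  proof -
    have "h i t = (if \<lfloor>of_int p * (t - a)\<rfloor> = i then H t else 0)" for i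
      by (simp add: h_def)
    then show ?thesis using inI[of t] by (auto simp: I_def)
  qed
  have H2sum: "(cmod (H t))\<^sup>2 = (\<Sum>i\<in>I. (cmod (h i t))\<^sup>2)" for t
  proof -
    have "(cmod (h i t))\<^sup>2 = (if \<lfloor>of_int p * (t - a)\<rfloor> = i then (cmod (H t))\<^sup>2 else 0)" for i
      by (simp add: h_def)
    then show ?thesis using inI[of t] by (auto simp: I_def)
  qed
  have Hc: "(LINT t|lebesgue. H t * cis (- 2 * pi * (\<beta> * of_int n) * t)) = (\<Sum>i\<in>I. c i n)" for n :: int
    unfolding Hsum sum_distrib_right c_def
    by (rule Bochner_Integration.integral_sum) (rule integrable_mult_cis[OF h])
  have piece: "(\<Sum>n\<in>N. (cmod (c i n))\<^sup>2) \<le> 1 / \<beta> * (LINT t|lebesgue. (cmod (h i t))\<^sup>2)" for i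
    unfolding c_def
  proof (rule bessel_on_period[OF \<open>\<beta> > 0\<close> h h2])
    fix t assume t: "t \<notin> {a + of_int i / of_int p..a + of_int i / of_int p + 1 / \<beta>}"
    show "h i t = 0"
    proof (rule ccontr)
      assume "h i t \<noteq> 0"
      then have "\<lfloor>of_int p * (t - a)\<rfloor> = i" by (auto simp: h_def)
      then have "of_int i \<le> of_int p * (t - a)" "of_int p * (t - a) \<le> of_int i + 1"
        by linarith+
      then have "of_int i / of_int p \<le> t - a" "t - a \<le> of_int i / of_int p + 1 / of_int p"
        using p by (simp_all add: field_simps)
      moreover have "1 / of_int p \<le> 1 / \<beta>" using p \<open>\<beta> > 0\<close> by (intro divide_left_mono) auto
      ultimately show False using t by auto
    qed
  qed fact
  have "(\<Sum>n\<in>N. (cmod (\<Sum>i\<in>I. c i n))\<^sup>2) \<le> (\<Sum>n\<in>N. of_int p * (\<Sum>i\<in>I. (cmod (c i n))\<^sup>2))"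
  proof (rule sum_mono)
    show "(cmod (\<Sum>i\<in>I. c i n))\<^sup>2 \<le> of_int p * (\<Sum>i\<in>I. (cmod (c i n))\<^sup>2)" for n
      using weighted_cauchy_schwarz[of I "\<lambda>_. 1" "\<lambda>i. c i n"] p by (simp add: I_def)
  qed
  also have "\<dots> = of_int p * (\<Sum>i\<in>I. \<Sum>n\<in>N. (cmod (c i n))\<^sup>2)"
    unfolding sum_distrib_left[symmetric] by (subst sum.swap) (rule refl)
  also have "\<dots> \<le> of_int p * (\<Sum>i\<in>I. 1 / \<beta> * (LINT t|lebesgue. (cmod (h i t))\<^sup>2))"
    using p by (intro mult_left_mono sum_mono piece) auto
  also have "\<dots> = of_int p / \<beta> * (LINT t|lebesgue. (cmod (H t))\<^sup>2)"
    unfolding H2sum sum_distrib_left[symmetric] by (simp add: Bochner_Integration.integral_sum h2)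
  finally show ?thesis unfolding Hc p_def .
qed

section \<open>Lebesgue measurability and null sets\<close>

lemma AE_lebesgue_translate:
  fixes c :: real
  assumes "AE t in lebesgue. P t"
  shows "AE t in lebesgue. P (t - c)"
proof -
  obtain N where N: "{t \<in> space lebesgue. \<not> P t} \<subseteq> N" "N \<in> null_sets lebesgue"
    using assms by (auto elim!: AE_E simp: null_sets_def)
  have "(+) c ` N \<in> null_sets lebesgue"
    using N(2) negligible_translation[of N c] by (simp add: negligible_iff_null_sets)
  then show ?thesis
  proof (rule AE_I')
    show "{t \<in> space lebesgue. \<not> P (t - c)} \<subseteq> (+) c ` N"
    proof
      fix t assume "t \<in> {t \<in> space lebesgue. \<not> P (t - c)}"
      then have "t - c \<in> N" using N(1) by auto
      then show "t \<in> (+) c ` N" by (intro image_eqI[of _ _ "t - c"]) auto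
    qed
  qed
qed

lemma borel_measurable_lebesgue_translate:
  fixes g :: "real \<Rightarrow> complex"
  assumes "g \<in> borel_measurable lebesgue"
  shows "(\<lambda>t. g (t - c)) \<in> borel_measurable lebesgue"
  using borel_measurable_affine[OF assms, of 1 "- c"] by simp

lemma measurable_floor_lebesgue[measurable]: "(floor :: real \<Rightarrow> int) \<in> lebesgue \<rightarrow>\<^sub>M count_space UNIV"
  by (rule measurable_completion) measurable

lemma borel_measurable_of_bool_floor[measurable]:
  "(\<lambda>t :: real. of_bool (\<lfloor>t\<rfloor> \<in> S) :: complex) \<in> borel_measurable lebesgue"
  using measurable_compose[OF measurable_floor_lebesgue, of "\<lambda>i. of_bool (i \<in> S) :: complex" borel] by simp

section \<open>Boundary terms of a cutoff\<close>

text \<open>A pair \<open>(k, k + m)\<close> that the interval \<open>{0..<N}\<close> separates has one of its entries in the interval, which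
leaves \<open>2N\<close> choices, and straddles one of the two endpoints, which leaves \<open>2\<bar>m\<bar>\<close> choices.\<close>

lemma card_indicator_jumps_le:
  fixes m N :: int
  assumes "finite K" "N \<ge> 0"
  shows "(\<Sum>k\<in>K. of_bool ((k + m \<in> {0..<N}) \<noteq> (k \<in> {0..<N}))) \<le> 2 * min \<bar>real_of_int m\<bar> (real_of_int N)"
proof -
  define A where "A = {k. (k + m \<in> {0..<N}) \<noteq> (k \<in> {0..<N})}"
  have "(\<Sum>k\<in>K. of_bool ((k + m \<in> {0..<N}) \<noteq> (k \<in> {0..<N})) :: real) = real (card (K \<inter> A))"
    using assms by (simp add: A_def Int_def of_bool_def sum.If_cases)
  also have "real (card (K \<inter> A)) \<le> 2 * min \<bar>real_of_int m\<bar> (real_of_int N)"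
  proof -
    define B where "B = {0..<N} \<union> {-m..<N - m}"
    define D where "D = {min 0 (-m)..<max 0 (-m)} \<union> {min N (N - m)..<max N (N - m)}"
    have "K \<inter> A \<subseteq> B" "K \<inter> A \<subseteq> D" by (auto simp: A_def B_def D_def)
    then have "card (K \<inter> A) \<le> card B" "card (K \<inter> A) \<le> card D"
      by (auto intro!: card_mono simp: B_def D_def)
    moreover have "card B \<le> nat N + nat N"
      unfolding B_def by (rule order_trans[OF card_Un_le]) simp
    moreover have "card D \<le> nat \<bar>m\<bar> + nat \<bar>m\<bar>"
      unfolding D_def by (rule order_trans[OF card_Un_le]) (auto simp: max_def min_def)
    ultimately have "real (card (K \<inter> A)) \<le> 2 * real (nat N)" "real (card (K \<inter> A)) \<le> 2 * real (nat \<bar>m\<bar>)"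
      by linarith+
    then show ?thesis using assms by (simp add: min_def)
  qed
  finally show ?thesis .
qed

text \<open>The number of jumps at distance \<open>m\<close> grows linearly in \<open>N\<close> at worst, but is bounded for each fixed \<open>m\<close>.
With summable weights, finitely many distances carry all but \<open>\<epsilon>/2\<close> of the total weight; they contribute
the constant \<open>L\<close> and all the others at most \<open>\<epsilon> N\<close>.\<close>

lemma weighted_jumps_sublinear:
  fixes w :: "int \<Rightarrow> real" and \<epsilon> :: real
  assumes pos: "\<And>m. w m > 0" and sw: "w summable_on UNIV" and "\<epsilon> > 0"
  obtains L where "\<And>N K J. \<lbrakk>finite K; finite J; N \<ge> 0\<rbrakk> \<Longrightarrow>
    (\<Sum>k\<in>K. \<Sum>j\<in>J. of_bool ((j \<in> {0..<N}) \<noteq> (k \<in> {0..<N})) * w (j - k)) \<le> L + \<epsilon> * of_int N"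
proof -
  define W where "W = infsum w UNIV"
  have "(w has_sum W) UNIV" using sw by (simp add: W_def)
  then have "\<forall>\<^sub>F M in finite_subsets_at_top UNIV. dist (sum w M) W < \<epsilon> / 2"
    using \<open>\<epsilon> > 0\<close> unfolding has_sum_def by (auto dest!: tendstoD[of _ _ _ "\<epsilon> / 2"])
  then obtain M0 where M0: "finite M0" and near: "\<And>M. finite M \<Longrightarrow> M0 \<subseteq> M \<Longrightarrow> dist (sum w M) W < \<epsilon> / 2"
    by (auto simp: eventually_finite_subsets_at_top)
  have M0': "W - \<epsilon> / 2 < sum w M0"
    using near[OF M0 order_refl] unfolding dist_real_def by linarith
  have tail: "sum w (M - M0) \<le> \<epsilon> / 2" if "finite M" for M
  proof -
    have "sum w M0 + sum w (M - M0) = sum w (M0 \<union> M)"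
      using M0 that by (subst sum.union_disjoint[symmetric]) auto
    also have "\<dots> \<le> W" unfolding W_def
      using M0 that pos by (intro finite_sum_le_infsum sw) (auto intro: less_imp_le)
    finally show ?thesis using M0' by linarith
  qed
  show thesis
  proof (rule that[of "\<Sum>m\<in>M0. w m * (2 * \<bar>of_int m\<bar>)"])
    fix N :: int and K J :: "int set"
    assume fin: "finite K" "finite J" and "N \<ge> 0"
    define jump where "jump k m = (of_bool ((k + m \<in> {0..<N}) \<noteq> (k \<in> {0..<N})) :: real)" for k m
    define M where "M = (\<lambda>(k, j). j - k) ` (K \<times> J)"
    have "finite M" using fin by (simp add: M_def)
    have "(\<Sum>k\<in>K. \<Sum>j\<in>J. of_bool ((j \<in> {0..<N}) \<noteq> (k \<in> {0..<N})) * w (j - k)) \<le> (\<Sum>k\<in>K. \<Sum>m\<in>M. jump k m * w m)"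
    proof (rule sum_mono)
      fix k assume "k \<in> K"
      have "(\<Sum>j\<in>J. of_bool ((j \<in> {0..<N}) \<noteq> (k \<in> {0..<N})) * w (j - k)) = (\<Sum>m\<in>(\<lambda>j. j - k) ` J. jump k m * w m)"
        by (subst sum.reindex) (auto simp: inj_on_def jump_def)
      also have "\<dots> \<le> (\<Sum>m\<in>M. jump k m * w m)"
        using \<open>finite M\<close> \<open>k \<in> K\<close> pos by (intro sum_mono2) (auto simp: M_def jump_def less_imp_le)
      finally show "(\<Sum>j\<in>J. of_bool ((j \<in> {0..<N}) \<noteq> (k \<in> {0..<N})) * w (j - k)) \<le> (\<Sum>m\<in>M. jump k m * w m)" .
    qed
    also have "\<dots> = (\<Sum>m\<in>M. w m * (\<Sum>k\<in>K. jump k m))"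
      by (subst sum.swap) (simp add: sum_distrib_left mult.commute)
    also have "\<dots> \<le> (\<Sum>m\<in>M. w m * (2 * min \<bar>of_int m\<bar> (of_int N)))"
      unfolding jump_def using card_indicator_jumps_le[OF fin(1) \<open>N \<ge> 0\<close>] pos
      by (intro sum_mono mult_left_mono) (auto intro: less_imp_le)
    also have "\<dots> = (\<Sum>m\<in>M \<inter> M0. w m * (2 * min \<bar>of_int m\<bar> (of_int N))) + (\<Sum>m\<in>M - M0. w m * (2 * min \<bar>of_int m\<bar> (of_int N)))"
      by (rule sum.Int_Diff[OF \<open>finite M\<close>])
    also have "\<dots> \<le> (\<Sum>m\<in>M0. w m * (2 * \<bar>of_int m\<bar>)) + \<epsilon> * of_int N"
    proof (rule add_mono)
      have "(\<Sum>m\<in>M \<inter> M0. w m * (2 * min \<bar>of_int m\<bar> (of_int N))) \<le> (\<Sum>m\<in>M \<inter> M0. w m * (2 * \<bar>of_int m\<bar>))"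
        using pos by (intro sum_mono mult_left_mono) (auto intro: less_imp_le)
      also have "\<dots> \<le> (\<Sum>m\<in>M0. w m * (2 * \<bar>of_int m\<bar>))"
        using M0 pos by (intro sum_mono2) (auto simp: less_imp_le)
      finally show "(\<Sum>m\<in>M \<inter> M0. w m * (2 * min \<bar>of_int m\<bar> (of_int N))) \<le> (\<Sum>m\<in>M0. w m * (2 * \<bar>of_int m\<bar>))" .
      have "(\<Sum>m\<in>M - M0. w m * (2 * min \<bar>of_int m\<bar> (of_int N))) \<le> (\<Sum>m\<in>M - M0. w m * (2 * of_int N))"
        using pos by (intro sum_mono mult_left_mono) (auto intro: less_imp_le)
      also have "\<dots> = sum w (M - M0) * (2 * of_int N)" by (simp only: sum_distrib_right)
      also have "\<dots> \<le> \<epsilon> / 2 * (2 * of_int N)"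
        using tail[OF \<open>finite M\<close>] \<open>N \<ge> 0\<close> by (intro mult_right_mono) auto
      finally show "(\<Sum>m\<in>M - M0. w m * (2 * min \<bar>of_int m\<bar> (of_int N))) \<le> \<epsilon> * of_int N" by simp
    qed
    finally show "(\<Sum>k\<in>K. \<Sum>j\<in>J. of_bool ((j \<in> {0..<N}) \<noteq> (k \<in> {0..<N})) * w (j - k))
        \<le> (\<Sum>m\<in>M0. w m * (2 * \<bar>of_int m\<bar>)) + \<epsilon> * of_int N" .
  qed
qed

section \<open>Truncations of an annihilated quasi-periodic function\<close>

text \<open>The situation of the theorem, with the membership of \<open>g\<close> in \<open>S0_space\<close> replaced by what is extracted from
it: summable bounds \<open>w\<close> for \<open>g\<close> on the unit intervals.\<close>

locale gabor_annihilated =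
  fixes \<nu> \<beta> :: real and g f :: "real \<Rightarrow> complex" and w :: "int \<Rightarrow> real"
  assumes beta: "\<beta> > 0"
    and g_meas[measurable]: "g \<in> borel_measurable lebesgue"
    and f_quasi: "f \<in> L2_quasi \<nu>"
    and w_pos: "\<And>m. w m > 0" and w_sum: "w summable_on UNIV"
    and g_le_w: "AE t in lebesgue. cmod (g t) \<le> w \<lfloor>t\<rfloor>"
    and annihilated: "\<And>n :: int. stft g f 0 (\<beta> * of_int n) = 0"
begin

definition energy :: real where
  "energy = (LINT t|lebesgue. of_bool (\<lfloor>t\<rfloor> = 0) * (cmod (f t))\<^sup>2)"

definition product :: "int \<Rightarrow> real \<Rightarrow> complex" where
  "product k t = f t * cnj (g (t - of_int k))"

definition block_coeff :: "int \<Rightarrow> int \<Rightarrow> int \<Rightarrow> complex" where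
  "block_coeff j k n =
     (LINT t|lebesgue. of_bool (\<lfloor>t\<rfloor> = j) * product k t * cis (- 2 * pi * (\<beta> * of_int n) * t))"

lemma f_meas[measurable]: "f \<in> borel_measurable lebesgue"
  using f_quasi by (simp add: L2_quasi_def)

lemma f_shift: "f (t + of_int k) = cis (2 * pi * of_int k * \<nu>) * f t"
  using f_quasi by (simp add: L2_quasi_def)

lemma product_meas[measurable]: "product k \<in> borel_measurable lebesgue"
proof -
  have [measurable]: "(\<lambda>t. g (t - of_int k)) \<in> borel_measurable lebesgue"
    by (rule borel_measurable_lebesgue_translate) measurable
  show ?thesis unfolding product_def[abs_def] by measurable
qed

lemma integrable_of_bool_floor: "integrable lebesgue (\<lambda>t :: real. of_bool (\<lfloor>t\<rfloor> = j) :: real)"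
proof -
  have "integrable lborel (indicator {of_int j..<of_int j + 1} :: real \<Rightarrow> real)"
    by (rule integrable_real_indicator) auto
  then have "integrable lebesgue (indicator {of_int j..<of_int j + 1} :: real \<Rightarrow> real)"
    by (subst integrable_completion) auto
  also have "(indicator {of_int j..<of_int j + 1} :: real \<Rightarrow> real) = (\<lambda>t. of_bool (\<lfloor>t\<rfloor> = j))"
    by (auto simp: fun_eq_iff indicator_def floor_eq_iff)
  finally show ?thesis .
qed

lemma block_energy:
  "integrable lebesgue (\<lambda>t. of_bool (\<lfloor>t\<rfloor> = j) * (cmod (f t))\<^sup>2)"
  "(LINT t|lebesgue. of_bool (\<lfloor>t\<rfloor> = j) * (cmod (f t))\<^sup>2) = energy"
proof -
  define u where "u j t = of_bool (\<lfloor>t\<rfloor> = j) * (cmod (f t))\<^sup>2" for j and t :: real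
  have shift: "u j (of_int j + 1 * t) = u 0 t" for t
    using f_shift[of t j] by (simp add: u_def norm_mult add.commute)
  have "integrable lebesgue (\<lambda>t. indicator {0<..<1} t *\<^sub>R (cmod (f t))\<^sup>2)"
    using f_quasi by (simp add: L2_quasi_def set_integrable_def)
  moreover have "AE t in lebesgue. t \<noteq> (0::real)" by (intro AE_completion AE_lborel_singleton)
  then have "AE t in lebesgue. indicator {0<..<1} t *\<^sub>R (cmod (f t))\<^sup>2 = u 0 t"
    by eventually_elim (auto simp: u_def indicator_def floor_eq_iff)
  moreover have "u 0 \<in> borel_measurable lebesgue" unfolding u_def[abs_def] by measurable
  ultimately have "integrable lebesgue (u 0)"
    by (subst integrable_cong_AE[symmetric]) (auto dest: borel_measurable_integrable)
  then have "integrable lebesgue (u j)"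
    using lebesgue_integrable_real_affine_iff[of 1 "u j" "of_int j"] unfolding shift by simp
  then show "integrable lebesgue (\<lambda>t. of_bool (\<lfloor>t\<rfloor> = j) * (cmod (f t))\<^sup>2)"
    by (simp add: u_def[abs_def])
  have "integral\<^sup>L lebesgue (u j) = integral\<^sup>L lebesgue (u 0)"
    using lebesgue_integral_real_affine[of 1 "u j" "of_int j"] unfolding shift by simp
  then show "(LINT t|lebesgue. of_bool (\<lfloor>t\<rfloor> = j) * (cmod (f t))\<^sup>2) = energy"
    by (simp add: u_def[abs_def] energy_def)
qed

lemma energy_nonneg: "energy \<ge> 0"
  unfolding energy_def by (intro integral_nonneg_AE) auto

text \<open>On the unit interval starting at \<open>j\<close>, the shifted window is at most \<open>w (j - k)\<close>. All decay in \<open>j - k\<close>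
comes from this bound, since the energy of \<open>f\<close> is the same on every unit interval.\<close>

lemma AE_product_le: "AE t in lebesgue. cmod (product k t) \<le> w (\<lfloor>t\<rfloor> - k) * cmod (f t)"
  using AE_lebesgue_translate[OF g_le_w, of "of_int k"]
  by eventually_elim (simp add: product_def norm_mult mult.commute mult_left_mono)

lemma block_product:
  shows "integrable lebesgue (\<lambda>t. of_bool (\<lfloor>t\<rfloor> = j) * product k t)"
    and "integrable lebesgue (\<lambda>t. (cmod (of_bool (\<lfloor>t\<rfloor> = j) * product k t))\<^sup>2)"
    and "(LINT t|lebesgue. (cmod (of_bool (\<lfloor>t\<rfloor> = j) * product k t))\<^sup>2) \<le> (w (j - k))\<^sup>2 * energy"
    and "(LINT t|lebesgue. cmod (of_bool (\<lfloor>t\<rfloor> = j) * product k t)) \<le> w (j - k) * (1 + energy)"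
proof -
  define h where "h t = of_bool (\<lfloor>t\<rfloor> = j) * product k t" for t :: real
  have hm[measurable]: "h \<in> borel_measurable lebesgue" unfolding h_def[abs_def] by measurable
  have le2: "AE t in lebesgue. (cmod (h t))\<^sup>2 \<le> (w (j - k))\<^sup>2 * (of_bool (\<lfloor>t\<rfloor> = j) * (cmod (f t))\<^sup>2)"
    using AE_product_le[of k]
  proof eventually_elim
    case (elim t)
    show ?case
      using power_mono[OF elim norm_ge_zero, of 2] by (auto simp: h_def power_mult_distrib)
  qed
  have le1: "AE t in lebesgue. cmod (h t) \<le> w (j - k) * (of_bool (\<lfloor>t\<rfloor> = j) + of_bool (\<lfloor>t\<rfloor> = j) * (cmod (f t))\<^sup>2)"
    using AE_product_le[of k]
  proof eventually_elim
    case (elim t)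
    \<comment> \<open>A crude bound of the first power by the square, good enough on a set of finite measure.\<close>
    have "cmod (f t) \<le> 1 + (cmod (f t))\<^sup>2"
      using sum_squares_bound[of 1 "cmod (f t)"] norm_ge_zero[of "f t"] unfolding power_one by linarith
    then have "w (\<lfloor>t\<rfloor> - k) * cmod (f t) \<le> w (\<lfloor>t\<rfloor> - k) * (1 + (cmod (f t))\<^sup>2)"
      using w_pos by (intro mult_left_mono) (auto intro: less_imp_le)
    with elim show ?case by (auto simp: h_def)
  qed
  have int2: "integrable lebesgue (\<lambda>t. (w (j - k))\<^sup>2 * (of_bool (\<lfloor>t\<rfloor> = j) * (cmod (f t))\<^sup>2))"
    by (intro integrable_mult_right block_energy)
  have int1: "integrable lebesgue (\<lambda>t. w (j - k) * (of_bool (\<lfloor>t\<rfloor> = j) + of_bool (\<lfloor>t\<rfloor> = j) * (cmod (f t))\<^sup>2))"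
    by (intro integrable_mult_right Bochner_Integration.integrable_add block_energy integrable_of_bool_floor)
  have h2: "integrable lebesgue (\<lambda>t. (cmod (h t))\<^sup>2)"
    using int2 by (rule Bochner_Integration.integrable_bound) (use le2 in auto)
  have h1: "integrable lebesgue h"
    using int1 by (rule Bochner_Integration.integrable_bound) (use le1 in \<open>auto elim!: eventually_mono\<close>)
  show "integrable lebesgue (\<lambda>t. of_bool (\<lfloor>t\<rfloor> = j) * product k t)"
    "integrable lebesgue (\<lambda>t. (cmod (of_bool (\<lfloor>t\<rfloor> = j) * product k t))\<^sup>2)"
    using h1 h2 by (simp_all add: h_def[abs_def])
  have "(LINT t|lebesgue. (cmod (h t))\<^sup>2) \<le> (LINT t|lebesgue. (w (j - k))\<^sup>2 * (of_bool (\<lfloor>t\<rfloor> = j) * (cmod (f t))\<^sup>2))"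
    by (rule integral_mono_AE[OF h2 int2 le2])
  then show "(LINT t|lebesgue. (cmod (of_bool (\<lfloor>t\<rfloor> = j) * product k t))\<^sup>2) \<le> (w (j - k))\<^sup>2 * energy"
    by (simp only: h_def integral_mult_right_zero block_energy)
  have floor1: "(LINT (t :: real)|lebesgue. of_bool (\<lfloor>t\<rfloor> = j)) = (1 :: real)"
  proof -
    have "(LINT (t :: real)|lebesgue. of_bool (\<lfloor>t\<rfloor> = j)) = (LINT t|lebesgue. indicator {of_int j..<of_int j + 1 :: real} t :: real)"
      by (intro Bochner_Integration.integral_cong) (auto simp: indicator_def floor_eq_iff)
    also have "\<dots> = 1" by simp
    finally show ?thesis .
  qed
  have "(LINT t|lebesgue. cmod (h t)) \<le> (LINT t|lebesgue. w (j - k) * (of_bool (\<lfloor>t\<rfloor> = j) + of_bool (\<lfloor>t\<rfloor> = j) * (cmod (f t))\<^sup>2))"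
    by (rule integral_mono_AE[OF integrable_norm[OF h1] int1 le1])
  also have "\<dots> = w (j - k) * (1 + energy)"
    by (simp only: integral_mult_right_zero Bochner_Integration.integral_add[OF integrable_of_bool_floor block_energy(1)] floor1 block_energy(2))
  finally show "(LINT t|lebesgue. cmod (of_bool (\<lfloor>t\<rfloor> = j) * product k t)) \<le> w (j - k) * (1 + energy)"
    by (simp only: h_def)
qed

lemma sum_w_shift_le: "finite J \<Longrightarrow> (\<Sum>j\<in>J. w (j - k)) \<le> infsum w UNIV"
proof -
  assume "finite J"
  have "(\<Sum>j\<in>J. w (j - k)) = sum w ((\<lambda>j. j - k) ` J)"
    by (subst sum.reindex) (auto simp: inj_on_def)
  also have "\<dots> \<le> infsum w UNIV"
    using w_pos \<open>finite J\<close> by (intro finite_sum_le_infsum w_sum) (auto intro: less_imp_le)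
  finally show ?thesis .
qed

lemma sum_blocks:
  fixes t :: real
  shows "(\<Sum>j\<in>{- int L..<int L}. of_bool (\<lfloor>t\<rfloor> = j) * c j) = (of_bool (\<lfloor>t\<rfloor> \<in> {- int L..<int L}) * c \<lfloor>t\<rfloor> :: 'a :: semiring_1)"
proof -
  have "(\<Sum>j\<in>{- int L..<int L}. of_bool (\<lfloor>t\<rfloor> = j) * c j) = (\<Sum>j\<in>{- int L..<int L}. if \<lfloor>t\<rfloor> = j then c j else 0)"
    by (intro sum.cong) auto
  then show ?thesis by simp
qed

lemma eventually_block: "\<forall>\<^sub>F L in sequentially. \<lfloor>t :: real\<rfloor> \<in> {- int L..<int L}"
  using eventually_gt_at_top[of "nat \<bar>\<lfloor>t\<rfloor>\<bar>"] by eventually_elim auto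

lemma product_integrable: "integrable lebesgue (product k)"
proof -
  define s where "s L t = of_bool (\<lfloor>t\<rfloor> \<in> {- int L..<int L}) * cmod (product k t)" for L and t :: real
  have s: "s L t = (\<Sum>j\<in>{- int L..<int L}. cmod (of_bool (\<lfloor>t\<rfloor> = j) * product k t))" for L t
  proof -
    have "(\<Sum>j\<in>{- int L..<int L}. cmod (of_bool (\<lfloor>t\<rfloor> = j) * product k t)) =
        (\<Sum>j\<in>{- int L..<int L}. of_bool (\<lfloor>t\<rfloor> = j) * cmod (product k t))"
      by (intro sum.cong refl) (simp add: norm_mult)
    also have "\<dots> = s L t" unfolding s_def by (rule sum_blocks)
    finally show ?thesis ..
  qed
  have sint: "integrable lebesgue (s L)" for L
    unfolding s[abs_def] by (intro Bochner_Integration.integrable_sum integrable_norm block_product)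
  have bound: "integral\<^sup>L lebesgue (s L) \<le> infsum w UNIV * (1 + energy)" for L
  proof -
    have "integral\<^sup>L lebesgue (s L) = (\<Sum>j\<in>{- int L..<int L}. LINT t|lebesgue. cmod (of_bool (\<lfloor>t\<rfloor> = j) * product k t))"
      unfolding s[abs_def] by (intro Bochner_Integration.integral_sum integrable_norm block_product)
    also have "\<dots> \<le> (\<Sum>j\<in>{- int L..<int L}. w (j - k) * (1 + energy))"
      by (intro sum_mono block_product)
    also have "\<dots> \<le> infsum w UNIV * (1 + energy)"
      unfolding sum_distrib_right[symmetric] using energy_nonneg
      by (intro mult_right_mono sum_w_shift_le) auto
    finally show ?thesis .
  qed
  have mono: "mono (\<lambda>L. s L t)" for t
    by (intro monoI) (auto simp: s_def)
  have "incseq (\<lambda>L. integral\<^sup>L lebesgue (s L))"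
    using mono by (intro monoI integral_mono sint) (auto dest: monoD)
  then obtain x where "(\<lambda>L. integral\<^sup>L lebesgue (s L)) \<longlonglongrightarrow> x"
    using incseq_convergent[of "\<lambda>L. integral\<^sup>L lebesgue (s L)" "infsum w UNIV * (1 + energy)"] bound by blast
  then have "integrable lebesgue (\<lambda>t. cmod (product k t))"
  proof (rule integrable_monotone_convergence[rotated 3])
    show "AE t in lebesgue. (\<lambda>L. s L t) \<longlonglongrightarrow> cmod (product k t)"
      by (intro AE_I2 tendsto_eventually eventually_mono[OF eventually_block]) (auto simp: s_def)
  qed (use sint mono in auto)
  then show ?thesis by (simp add: integrable_norm_iff)
qed

lemma block_coeff_bessel:
  assumes "finite N"
  shows "(\<Sum>n\<in>N. (cmod (block_coeff j k n))\<^sup>2) \<le> of_int \<lceil>\<beta>\<rceil> / \<beta> * ((w (j - k))\<^sup>2 * energy)"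
proof -
  have "(\<Sum>n\<in>N. (cmod (block_coeff j k n))\<^sup>2)
      \<le> of_int \<lceil>\<beta>\<rceil> / \<beta> * (LINT t|lebesgue. (cmod (of_bool (\<lfloor>t\<rfloor> = j) * product k t))\<^sup>2)"
    unfolding block_coeff_def
    by (rule bessel_on_unit_interval[OF beta block_product(1,2) _ assms, of "of_int j"]) (auto simp: floor_eq_iff)
  also have "\<dots> \<le> of_int \<lceil>\<beta>\<rceil> / \<beta> * ((w (j - k))\<^sup>2 * energy)"
    using beta by (intro mult_left_mono block_product divide_nonneg_pos) auto
  finally show ?thesis .
qed

text \<open>Orthogonality to the modulated windows at position 0 extends to position \<open>k\<close>: translation by \<open>k\<close> changes
\<open>f\<close>, as well as the exponential, only by a constant factor of modulus 1.\<close>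

lemma product_orthogonal: "(LINT t|lebesgue. product k t * cis (- 2 * pi * (\<beta> * of_int n) * t)) = 0"
proof -
  have "(LINT t|lebesgue. product k t * cis (- 2 * pi * (\<beta> * of_int n) * t)) =
      (LINT t|lebesgue. product k (of_int k + 1 * t) * cis (- 2 * pi * (\<beta> * of_int n) * (of_int k + 1 * t)))"
    by (subst lebesgue_integral_real_affine[of 1 _ "of_int k"]) auto
  also have "\<dots> = (LINT t|lebesgue. cis (2 * pi * of_int k * \<nu>) * cis (- 2 * pi * (\<beta> * of_int n) * of_int k) *
      (f t * cnj (g (t - 0)) * cis (- 2 * pi * (\<beta> * of_int n) * t)))"
  proof (intro Bochner_Integration.integral_cong refl)
    fix t :: real
    have "cis (- 2 * pi * (\<beta> * of_int n) * (of_int k + 1 * t)) =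
        cis (- 2 * pi * (\<beta> * of_int n) * of_int k) * cis (- 2 * pi * (\<beta> * of_int n) * t)"
      by (simp add: cis_mult algebra_simps)
    moreover have "product k (of_int k + 1 * t) = cis (2 * pi * of_int k * \<nu>) * (f t * cnj (g (t - 0)))"
      using f_shift[of t k] by (simp add: product_def add.commute)
    ultimately show "product k (of_int k + 1 * t) * cis (- 2 * pi * (\<beta> * of_int n) * (of_int k + 1 * t)) =
        cis (2 * pi * of_int k * \<nu>) * cis (- 2 * pi * (\<beta> * of_int n) * of_int k) *
        (f t * cnj (g (t - 0)) * cis (- 2 * pi * (\<beta> * of_int n) * t))"
      by (simp only: mult_ac)
  qed
  also have "\<dots> = cis (2 * pi * of_int k * \<nu>) * cis (- 2 * pi * (\<beta> * of_int n) * of_int k) * stft g f 0 (\<beta> * of_int n)"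
    unfolding stft_def by (rule integral_mult_right_zero)
  finally show ?thesis by (simp add: annihilated)
qed

definition truncation :: "int \<Rightarrow> real \<Rightarrow> complex" where
  "truncation N t = of_bool (\<lfloor>t\<rfloor> \<in> {0..<N}) * f t"

lemma truncation_energy:
  assumes "N \<ge> 0"
  shows "truncation N \<in> L2_space" and "(L2_norm (truncation N))\<^sup>2 = of_int N * energy"
proof -
  have eq: "(cmod (truncation N t))\<^sup>2 = (\<Sum>j\<in>{0..<N}. of_bool (\<lfloor>t\<rfloor> = j) * (cmod (f t))\<^sup>2)" for t
  proof -
    have "(\<Sum>j\<in>{0..<N}. of_bool (\<lfloor>t\<rfloor> = j) * (cmod (f t))\<^sup>2) = (\<Sum>j\<in>{0..<N}. if \<lfloor>t\<rfloor> = j then (cmod (f t))\<^sup>2 else 0)"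
      by (intro sum.cong) auto
    then show ?thesis by (simp add: truncation_def norm_mult)
  qed
  have [measurable]: "truncation N \<in> borel_measurable lebesgue"
    unfolding truncation_def[abs_def] by measurable
  have int: "integrable lebesgue (\<lambda>t. (cmod (truncation N t))\<^sup>2)"
    unfolding eq by (intro Bochner_Integration.integrable_sum block_energy)
  then show "truncation N \<in> L2_space" by (simp add: L2_space_def)
  have "(L2_norm (truncation N))\<^sup>2 = (LINT t|lebesgue. (cmod (truncation N t))\<^sup>2)"
    unfolding L2_norm_def by (intro real_sqrt_pow2 integral_nonneg_AE) auto
  also have "\<dots> = (\<Sum>j\<in>{0..<N}. energy)"
    unfolding eq
    by (subst Bochner_Integration.integral_sum, rule block_energy(1), simp only: block_energy(2))
  finally show "(L2_norm (truncation N))\<^sup>2 = of_int N * energy" using assms by simp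
qed

text \<open>The heart of the argument. Since \<open>f\<close> is orthogonal to the Gabor atom at position \<open>k\<close>, the constant value
that the cutoff takes near \<open>k\<close> may be subtracted from the cutoff without changing the coefficient. What
remains are the unit intervals \<open>j\<close> separated from \<open>k\<close> by an endpoint of the cutoff. A limit
of partial sums is stated because the estimates below concern finitely many intervals at a time.\<close>

lemma truncation_coeff_tendsto:
  "(\<lambda>L. \<Sum>j\<in>{- int L..<int L}. (of_bool (j \<in> {0..<N}) - of_bool (k \<in> {0..<N})) * block_coeff j k n)
     \<longlonglongrightarrow> L2_inner (truncation N) (gabor_system g (of_int k, \<beta> * of_int n))"
proof -
  define e where "e t = cis (- 2 * pi * (\<beta> * of_int n) * t)" for t
  define \<delta> where "\<delta> j = (of_bool (j \<in> {0..<N}) - of_bool (k \<in> {0..<N}) :: complex)" for j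
  have \<delta>: "cmod (\<delta> j) \<le> 1" for j by (simp add: \<delta>_def)
  have em[measurable]: "e \<in> borel_measurable lebesgue"
    unfolding e_def[abs_def] by measurable
  have pe: "integrable lebesgue (\<lambda>t. product k t * e t)"
    unfolding e_def by (rule integrable_mult_cis[OF product_integrable])
  have dpe: "integrable lebesgue (\<lambda>t. of_bool (\<lfloor>t\<rfloor> \<in> {0..<N}) * (product k t * e t))"
  proof (rule Bochner_Integration.integrable_bound[OF pe])
    show "AE t in lebesgue. norm (of_bool (\<lfloor>t\<rfloor> \<in> {0..<N}) * (product k t * e t)) \<le> norm (product k t * e t)"
      by (intro AE_I2) (simp add: norm_mult)
  qed measurable
  have "L2_inner (truncation N) (gabor_system g (of_int k, \<beta> * of_int n)) =
      (LINT t|lebesgue. of_bool (\<lfloor>t\<rfloor> \<in> {0..<N}) * (product k t * e t))"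
    unfolding L2_inner_def
    by (intro Bochner_Integration.integral_cong refl)
       (simp add: truncation_def gabor_system_def modulation_def translation_def product_def e_def cis_cnj mult_ac)
  also have "\<dots> = (LINT t|lebesgue. of_bool (\<lfloor>t\<rfloor> \<in> {0..<N}) * (product k t * e t)) -
      of_bool (k \<in> {0..<N}) * (LINT t|lebesgue. product k t * e t)"
    using product_orthogonal[of k n] by (simp add: e_def)
  also have "\<dots> = (LINT t|lebesgue. of_bool (\<lfloor>t\<rfloor> \<in> {0..<N}) * (product k t * e t) -
      of_bool (k \<in> {0..<N}) * (product k t * e t))"
    using pe dpe by (subst Bochner_Integration.integral_diff) auto
  also have "\<dots> = (LINT t|lebesgue. \<delta> \<lfloor>t\<rfloor> * (product k t * e t))"
    by (intro Bochner_Integration.integral_cong refl) (simp add: \<delta>_def left_diff_distrib)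
  finally have inner: "L2_inner (truncation N) (gabor_system g (of_int k, \<beta> * of_int n)) =
      (LINT t|lebesgue. \<delta> \<lfloor>t\<rfloor> * (product k t * e t))" .
  have partial: "(\<Sum>j\<in>{- int L..<int L}. \<delta> j * block_coeff j k n) =
      (LINT t|lebesgue. of_bool (\<lfloor>t\<rfloor> \<in> {- int L..<int L}) * (\<delta> \<lfloor>t\<rfloor> * (product k t * e t)))" for L
  proof -
    have "(\<Sum>j\<in>{- int L..<int L}. \<delta> j * block_coeff j k n) =
        (\<Sum>j\<in>{- int L..<int L}. LINT t|lebesgue. \<delta> j * (of_bool (\<lfloor>t\<rfloor> = j) * product k t * e t))"
      by (simp add: block_coeff_def e_def)
    also have "\<dots> = (LINT t|lebesgue. (\<Sum>j\<in>{- int L..<int L}. \<delta> j * (of_bool (\<lfloor>t\<rfloor> = j) * product k t * e t)))"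
      unfolding e_def
      by (rule Bochner_Integration.integral_sum[symmetric]) (intro integrable_mult_right integrable_mult_cis block_product)
    also have "(\<lambda>t. \<Sum>j\<in>{- int L..<int L}. \<delta> j * (of_bool (\<lfloor>t\<rfloor> = j) * product k t * e t)) =
        (\<lambda>t. of_bool (\<lfloor>t\<rfloor> \<in> {- int L..<int L}) * (\<delta> \<lfloor>t\<rfloor> * (product k t * e t)))"
    proof
      fix t
      show "(\<Sum>j\<in>{- int L..<int L}. \<delta> j * (of_bool (\<lfloor>t\<rfloor> = j) * product k t * e t)) =
          of_bool (\<lfloor>t\<rfloor> \<in> {- int L..<int L}) * (\<delta> \<lfloor>t\<rfloor> * (product k t * e t))"
        unfolding sum_blocks[where c = "\<lambda>j. \<delta> j * (product k t * e t)", symmetric]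
        by (intro sum.cong refl) (simp only: mult_ac)
    qed
    finally show ?thesis .
  qed
  have "(\<lambda>L. LINT t|lebesgue. of_bool (\<lfloor>t\<rfloor> \<in> {- int L..<int L}) * (\<delta> \<lfloor>t\<rfloor> * (product k t * e t)))
      \<longlonglongrightarrow> (LINT t|lebesgue. \<delta> \<lfloor>t\<rfloor> * (product k t * e t))"
  proof (rule integral_dominated_convergence[where w = "\<lambda>t. cmod (product k t)"])
    show "integrable lebesgue (\<lambda>t. cmod (product k t))" by (rule integrable_norm[OF product_integrable])
    show "AE t in lebesgue. (\<lambda>L. of_bool (\<lfloor>t\<rfloor> \<in> {- int L..<int L}) * (\<delta> \<lfloor>t\<rfloor> * (product k t * e t)))
        \<longlonglongrightarrow> \<delta> \<lfloor>t\<rfloor> * (product k t * e t)"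
      by (intro AE_I2 tendsto_eventually eventually_mono[OF eventually_block]) auto
    show "AE t in lebesgue. norm (of_bool (\<lfloor>t\<rfloor> \<in> {- int L..<int L}) * (\<delta> \<lfloor>t\<rfloor> * (product k t * e t))) \<le> cmod (product k t)" for L
      using \<delta> by (intro AE_I2) (simp add: norm_mult e_def mult_left_le_one_le)
  qed (unfold \<delta>_def, measurable)
  then show ?thesis unfolding inner partial[symmetric] unfolding \<delta>_def .
qed

text \<open>Cauchy-Schwarz with weights \<open>w (j - k)\<close> separates the intervals \<open>j\<close>, the Bessel inequality sums over the
frequencies \<open>n\<close> and yields \<open>(w (j - k))\<^sup>2\<close>, and division by the weight leaves \<open>w (j - k)\<close>
for each pair \<open>(k, j)\<close> separated by the cutoff. The total weight \<open>E\<close> of these pairs does not depend on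
how many positions \<open>j\<close> are kept, so the bound passes to the limit.\<close>

lemma truncation_coeff_sum_le:
  fixes K M :: "int set" and N :: int and E :: real
  assumes "finite K" "finite M"
    and E: "\<And>J. finite J \<Longrightarrow> (\<Sum>k\<in>K. \<Sum>j\<in>J. of_bool ((j \<in> {0..<N}) \<noteq> (k \<in> {0..<N})) * w (j - k)) \<le> E"
  shows "(\<Sum>k\<in>K. \<Sum>n\<in>M. (cmod (L2_inner (truncation N) (gabor_system g (of_int k, \<beta> * of_int n))))\<^sup>2)
    \<le> infsum w UNIV * (of_int \<lceil>\<beta>\<rceil> / \<beta> * energy) * E"
proof -
  define W where "W = infsum w UNIV"
  define C where "C = of_int \<lceil>\<beta>\<rceil> / \<beta>"
  define \<delta> where "\<delta> k j = (of_bool (j \<in> {0..<N}) - of_bool (k \<in> {0..<N}) :: complex)" for k j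
  define d where "d k j = (of_bool ((j \<in> {0..<N}) \<noteq> (k \<in> {0..<N})) :: real)" for k j
  have \<delta>d: "(cmod (\<delta> k j))\<^sup>2 = d k j" for k j by (simp add: \<delta>_def d_def)
  have "W \<ge> 0" unfolding W_def using w_pos by (intro infsum_nonneg less_imp_le)
  have "C \<ge> 0" unfolding C_def using beta by (intro divide_nonneg_pos) auto
  have finite_bound: "(\<Sum>k\<in>K. \<Sum>n\<in>M. (cmod (\<Sum>j\<in>J. \<delta> k j * block_coeff j k n))\<^sup>2) \<le> W * (C * energy) * E"
    if "finite J" for J
  proof -
    have "(\<Sum>n\<in>M. (cmod (\<Sum>j\<in>J. \<delta> k j * block_coeff j k n))\<^sup>2) \<le> W * (\<Sum>j\<in>J. C * energy * (d k j * w (j - k)))" for k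
    proof -
      have "(\<Sum>n\<in>M. (cmod (\<Sum>j\<in>J. \<delta> k j * block_coeff j k n))\<^sup>2)
          \<le> (\<Sum>n\<in>M. W * (\<Sum>j\<in>J. d k j * (cmod (block_coeff j k n))\<^sup>2 / w (j - k)))"
      proof (rule sum_mono)
        fix n
        have "(cmod (\<Sum>j\<in>J. \<delta> k j * block_coeff j k n))\<^sup>2
            \<le> (\<Sum>j\<in>J. w (j - k)) * (\<Sum>j\<in>J. (cmod (\<delta> k j * block_coeff j k n))\<^sup>2 / w (j - k))"
          by (rule weighted_cauchy_schwarz) (rule w_pos)
        also have "\<dots> \<le> W * (\<Sum>j\<in>J. (cmod (\<delta> k j * block_coeff j k n))\<^sup>2 / w (j - k))"
          unfolding W_def using w_pos
          by (intro mult_right_mono sum_w_shift_le that sum_nonneg divide_nonneg_pos) auto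
        finally show "(cmod (\<Sum>j\<in>J. \<delta> k j * block_coeff j k n))\<^sup>2
            \<le> W * (\<Sum>j\<in>J. d k j * (cmod (block_coeff j k n))\<^sup>2 / w (j - k))"
          by (simp add: norm_mult power_mult_distrib \<delta>d)
      qed
      also have "\<dots> = W * (\<Sum>j\<in>J. d k j / w (j - k) * (\<Sum>n\<in>M. (cmod (block_coeff j k n))\<^sup>2))"
        unfolding sum_distrib_left[symmetric]
        by (subst sum.swap) (simp add: sum_distrib_left)
      also have "\<dots> \<le> W * (\<Sum>j\<in>J. d k j / w (j - k) * (C * ((w (j - k))\<^sup>2 * energy)))"
        unfolding C_def using \<open>W \<ge> 0\<close> w_pos
        by (intro mult_left_mono sum_mono block_coeff_bessel \<open>finite M\<close> divide_nonneg_pos) (auto simp: d_def)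
      also have "(\<Sum>j\<in>J. d k j / w (j - k) * (C * ((w (j - k))\<^sup>2 * energy))) = (\<Sum>j\<in>J. C * energy * (d k j * w (j - k)))"
        using w_pos by (intro sum.cong refl) (simp add: field_simps power2_eq_square less_imp_neq[symmetric])
      finally show ?thesis .
    qed
    then have "(\<Sum>k\<in>K. \<Sum>n\<in>M. (cmod (\<Sum>j\<in>J. \<delta> k j * block_coeff j k n))\<^sup>2)
        \<le> (\<Sum>k\<in>K. W * (\<Sum>j\<in>J. C * energy * (d k j * w (j - k))))"
      by (intro sum_mono)
    also have "\<dots> = W * (C * energy) * (\<Sum>k\<in>K. \<Sum>j\<in>J. d k j * w (j - k))"
      by (simp add: sum_distrib_left mult.assoc)
    also have "\<dots> \<le> W * (C * energy) * E"
      unfolding d_def using \<open>W \<ge> 0\<close> \<open>C \<ge> 0\<close> energy_nonneg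
      by (intro mult_left_mono E that mult_nonneg_nonneg) auto
    finally show ?thesis .
  qed
  have "(\<lambda>L. \<Sum>k\<in>K. \<Sum>n\<in>M. (cmod (\<Sum>j\<in>{- int L..<int L}. \<delta> k j * block_coeff j k n))\<^sup>2)
      \<longlonglongrightarrow> (\<Sum>k\<in>K. \<Sum>n\<in>M. (cmod (L2_inner (truncation N) (gabor_system g (of_int k, \<beta> * of_int n))))\<^sup>2)"
    unfolding \<delta>_def by (intro tendsto_sum tendsto_power tendsto_norm truncation_coeff_tendsto)
  then show ?thesis
    unfolding W_def[symmetric] C_def[symmetric]
    by (rule LIMSEQ_le_const2) (use finite_bound in auto)
qed

lemma energy_pos:
  assumes "\<not> (AE t in lebesgue. f t = 0)"
  shows "energy > 0"
proof (rule ccontr)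
  assume "\<not> energy > 0"
  then have "energy = 0" using energy_nonneg by simp
  have "AE t in lebesgue. of_bool (\<lfloor>t\<rfloor> = j) * (cmod (f t))\<^sup>2 = 0" for j
    using integral_nonneg_eq_0_iff_AE[OF block_energy(1)[of j]] \<open>energy = 0\<close> block_energy(2)[of j] by auto
  then have "AE t in lebesgue. \<forall>j. of_bool (\<lfloor>t\<rfloor> = j) * (cmod (f t))\<^sup>2 = 0"
    by (subst AE_all_countable) blast
  then have "AE t in lebesgue. f t = 0"
    by eventually_elim auto
  with assms show False by blast
qed

lemma lattice_finite_subset:
  assumes "finite F" "F \<subseteq> rect_lattice \<beta>"
  obtains K M :: "int set" where "finite K" "finite M"
    "F \<subseteq> (\<lambda>(k, n). (of_int k, \<beta> * of_int n)) ` (K \<times> M)"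
proof -
  have "\<forall>p\<in>F. \<exists>q :: int \<times> int. p = (of_int (fst q), \<beta> * of_int (snd q))"
    using assms(2) by (force simp: rect_lattice_def)
  then obtain q :: "real \<times> real \<Rightarrow> int \<times> int" where q: "\<And>p. p \<in> F \<Longrightarrow> p = (of_int (fst (q p)), \<beta> * of_int (snd (q p)))"
    by metis
  show thesis
  proof
    show "F \<subseteq> (\<lambda>(k, n). (of_int k, \<beta> * of_int n)) ` ((fst \<circ> q) ` F \<times> (snd \<circ> q) ` F)"
    proof
      fix p assume "p \<in> F"
      then show "p \<in> (\<lambda>(k, n). (of_int k, \<beta> * of_int n)) ` ((fst \<circ> q) ` F \<times> (snd \<circ> q) ` F)"
        using q[of p] by (intro image_eqI[of _ _ "q p"]) (auto simp: case_prod_beta mem_Times_iff)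
    qed
  qed (use assms in auto)
qed

text \<open>The truncation to \<open>N\<close> unit intervals has squared norm \<open>N\<close> times the energy, while its coefficients have
squared sum at most a constant times the energy times \<open>R + \<epsilon> N\<close>, with \<open>\<epsilon>\<close> arbitrarily small.\<close>

lemma not_gabor_frame:
  assumes "\<not> (AE t in lebesgue. f t = 0)"
  shows "\<not> gabor_frame g (rect_lattice \<beta>)"
proof
  assume "gabor_frame g (rect_lattice \<beta>)"
  then obtain A where "A > 0" and
    summable: "\<And>h. h \<in> L2_space \<Longrightarrow> (\<lambda>p. (cmod (L2_inner h (gabor_system g p)))\<^sup>2) summable_on rect_lattice \<beta>" and
    lower: "\<And>h. h \<in> L2_space \<Longrightarrow>
      A * (L2_norm h)\<^sup>2 \<le> (\<Sum>\<^sub>\<infinity>p\<in>rect_lattice \<beta>. (cmod (L2_inner h (gabor_system g p)))\<^sup>2)"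
    unfolding gabor_frame_def L2_frame_def by blast
  define C where "C = infsum w UNIV * (of_int \<lceil>\<beta>\<rceil> / \<beta>)"
  have "infsum w UNIV > 0"
  proof -
    have "0 < sum w {0}" using w_pos by simp
    also have "\<dots> \<le> infsum w UNIV" using w_pos by (intro finite_sum_le_infsum w_sum) (auto intro: less_imp_le)
    finally show ?thesis .
  qed
  then have "C > 0" unfolding C_def using beta by simp
  \<comment> \<open>With this value the part of the upper bound that is linear in \<open>N\<close> is half of the lower frame bound.\<close>
  define \<epsilon> where "\<epsilon> = A / (2 * C)"
  have "\<epsilon> > 0" using \<open>A > 0\<close> \<open>C > 0\<close> by (simp add: \<epsilon>_def)
  obtain R where R: "\<And>N K J. \<lbrakk>finite K; finite J; N \<ge> 0\<rbrakk> \<Longrightarrow>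
    (\<Sum>k\<in>K. \<Sum>j\<in>J. of_bool ((j \<in> {0..<N}) \<noteq> (k \<in> {0..<N})) * w (j - k)) \<le> R + \<epsilon> * of_int N"
    by (rule weighted_jumps_sublinear[OF w_pos w_sum \<open>\<epsilon> > 0\<close>]) (rule that, blast)
  have key: "A * (of_int N * energy) \<le> C * energy * (R + \<epsilon> * of_int N)" if "N \<ge> 0" for N :: int
  proof -
    define S where "S p = (cmod (L2_inner (truncation N) (gabor_system g p)))\<^sup>2" for p
    have "infsum S (rect_lattice \<beta>) \<le> C * energy * (R + \<epsilon> * of_int N)"
    proof (rule infsum_le_finite_sums)
      show "S summable_on rect_lattice \<beta>"
        unfolding S_def by (rule summable[OF truncation_energy(1)[OF that]])
      fix F assume "finite F" "F \<subseteq> rect_lattice \<beta>"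
      then obtain K M :: "int set" where KM: "finite K" "finite M"
        and F: "F \<subseteq> (\<lambda>(k, n). (of_int k, \<beta> * of_int n)) ` (K \<times> M)"
        by (rule lattice_finite_subset)
      have "sum S F \<le> sum S ((\<lambda>(k, n). (of_int k, \<beta> * of_int n)) ` (K \<times> M))"
        using F KM by (intro sum_mono2) (auto simp: S_def)
      also have "\<dots> = (\<Sum>k\<in>K. \<Sum>n\<in>M. S (of_int k, \<beta> * of_int n))"
        using beta by (subst sum.reindex) (auto simp: inj_on_def sum.cartesian_product case_prod_beta)
      also have "\<dots> \<le> infsum w UNIV * (of_int \<lceil>\<beta>\<rceil> / \<beta> * energy) * (R + \<epsilon> * of_int N)"
        unfolding S_def using KM that by (intro truncation_coeff_sum_le R)
      also have "\<dots> = C * energy * (R + \<epsilon> * of_int N)" by (simp add: C_def)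
      finally show "sum S F \<le> C * energy * (R + \<epsilon> * of_int N)" .
    qed
    with lower[OF truncation_energy(1)[OF that]] show ?thesis
      by (simp add: S_def[abs_def] truncation_energy(2)[OF that])
  qed
  have "A / 2 * of_int N \<le> C * R" if "N \<ge> 0" for N :: int
  proof -
    have "energy * (A * of_int N) \<le> energy * (C * (R + \<epsilon> * of_int N))"
      using key[OF that] by (simp add: mult_ac)
    then have "A * of_int N \<le> C * (R + \<epsilon> * of_int N)"
      using energy_pos[OF assms] by (rule mult_left_le_imp_le)
    also have "\<dots> = C * R + A / 2 * of_int N"
      using \<open>C > 0\<close> by (simp add: \<epsilon>_def distrib_left)
    finally show ?thesis by simp
  qed
  moreover define N where "N = \<lceil>\<bar>C * R\<bar> / (A / 2)\<rceil> + 1"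
  have N: "\<bar>C * R\<bar> / (A / 2) < of_int N" unfolding N_def by linarith
  moreover have "0 \<le> \<bar>C * R\<bar> / (A / 2)" using \<open>A > 0\<close> by (intro divide_nonneg_pos) auto
  then have "N \<ge> 0" using N by linarith
  ultimately have "A / 2 * of_int N \<le> C * R" by blast
  moreover have "\<bar>C * R\<bar> < A / 2 * of_int N"
    using N \<open>A > 0\<close> by (simp add: field_simps)
  ultimately show False by linarith
qed

end

section \<open>No Gabor frame\<close>

theorem corollary3:
  fixes \<nu> \<beta> :: real and g :: "real \<Rightarrow> complex"
  assumes "\<beta> > 0"
    and "g \<in> S0_space"
    and "L2_norm g = 1"
    and "\<exists>f\<in>L2_quasi \<nu>. \<not> (AE t in lebesgue. f t = 0) \<and>
           (\<forall>n::int. stft g f 0 (\<beta> * of_int n) = 0)"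
  shows "\<not> gabor_frame g (rect_lattice \<beta>)"
proof -
  obtain f where f: "f \<in> L2_quasi \<nu>" "\<not> (AE t in lebesgue. f t = 0)"
    "\<And>n::int. stft g f 0 (\<beta> * of_int n) = 0"
    using assms(4) by blast
  obtain w :: "int \<Rightarrow> real" where w: "\<And>m. w m > 0" "w summable_on UNIV"
    "AE t in lebesgue. cmod (g t) \<le> w \<lfloor>t\<rfloor>"
    using S0_amalgam_bound[OF assms(2)] by blast
  interpret gabor_annihilated \<nu> \<beta> g f w
    using assms f w by unfold_locales (auto simp: S0_space_def L2_space_def)
  show ?thesis by (rule not_gabor_frame[OF f(2)])
qed

end
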